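(* Let $\zeta$ be a Poisson point process on $\mathbb X$ with finite intensity measure $M$, with associated operators $(P_t)_{t\ge0}$ and infinitesimal generator $L$ as defined in the context. For any measurable $F:\widehat N_{\mathbb X}\to\mathbb R$ which is $1$-Lipschitz for $\Delta_{TV}$ and any $\phi\in\widehat N_{\mathbb X}$, $$\mathbb E[F(\zeta)]-F(\phi)=\int_0^{+\infty}LP_sF(\phi)\,\mathrm ds.$$
   Context: $\mathbb X$ is a locally compact metric space with its Borel $\sigma$-algebra. $\widehat N_{\mathbb X}$ is the set of finite configurations, i.e. finite nonnegative-integer-valued measures on $\mathbb X$, with the smallest $\sigma$-algebra making $\phi\mapsto\phi(A)$ measurable for every relatively compact Borel $A$; configurations are treated as (multi)sets of points. For $\nu_1,\nu_2\in\widehat N_{\mathbb X}$, $\Delta_{TV}(\nu_1,\nu_2)=\sup_A|\nu_1(A)-\nu_2(A)|$ over Borel sets $A$; $F$ is $1$-Lipschitz if $|F(\nu_1)-F(\nu_2)|\le\Delta_{TV}(\nu_1,\nu_2)$ for all $\nu_1,\nu_2$. For $p\in[0,1]$ and a configuration (or point process) $\phi$, $p\circ\phi$ is the independent $p$-thinning: each point of $\phi$ is kept independently with probability $p$. The Glauber process is $G_t(\phi)=e^{-t}\circ\phi+(1-e^{-t})\circ\zeta$, where the two thinnings and $\zeta$ are independent, and $P_tF(\phi)=\mathbb E[F(G_t(\phi))]$ for $t\ge0$, $\phi\in\widehat N_{\mathbb X}$ and $F:\widehat N_{\mathbb X}\to\mathbb R$ measurable which is bounded or $\Delta_{TV}$-Lipschitz.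 The infinitesimal generator is $LF(\phi)=\frac{\mathrm d P_tF(\phi)}{\mathrm dt}\big|_{t=0}$ whenever the derivative exists. *)

theory Defs
  imports "HOL-Probability.Probability" "HOL-Library.Multiset"
begin

text \<open>
  A finite configuration on the space \<open>'a\<close> is a finite multiset of points; it stands for the
  finite integer-valued measure \<open>A \<mapsto> npts \<phi> A\<close>, and superposition is multiset union \<open>+\<close>.
\<close>

definition npts :: "'a multiset \<Rightarrow> 'a set \<Rightarrow> nat" where
  "npts \<phi> A = size (filter_mset (\<lambda>x. x \<in> A) \<phi>)"

definition config_space :: "'a::metric_space multiset measure" where
  "config_space = sigma UNIV
     {(\<lambda>\<phi>. npts \<phi> A) -` B | A B. A \<in> sets borel \<and> compact (closure A)}"

definition TV_dist :: "'a::metric_space multiset \<Rightarrow> 'a multiset \<Rightarrow> real" where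
  "TV_dist \<nu>1 \<nu>2 = (SUP A\<in>sets borel. \<bar>real (npts \<nu>1 A) - real (npts \<nu>2 A)\<bar>)"

definition TV_lipschitz1 :: "('a::metric_space multiset \<Rightarrow> real) \<Rightarrow> bool" where
  "TV_lipschitz1 F \<longleftrightarrow> (\<forall>\<nu>1 \<nu>2. \<bar>F \<nu>1 - F \<nu>2\<bar> \<le> TV_dist \<nu>1 \<nu>2)"

text \<open>
  The number of points in \<open>A\<close> is Poisson with parameter \<open>M A\<close>, written out with its
  probabilities because the library's \<open>poisson_pmf\<close> requires a positive rate, whereas
  \<open>M A = 0\<close> (almost surely no point in \<open>A\<close>) has to be covered; here \<open>0 ^ 0 = 1\<close>.
  The measurability of the counts is required for every Borel set, since \<open>config_space\<close> only
  provides it for the relatively compact ones (and their countable unions).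
\<close>

definition poisson_process ::
  "'w measure \<Rightarrow> ('w \<Rightarrow> 'a::metric_space multiset) \<Rightarrow> 'a measure \<Rightarrow> bool" where
  "poisson_process \<Omega> \<zeta> M \<longleftrightarrow>
     prob_space \<Omega> \<and>
     \<zeta> \<in> \<Omega> \<rightarrow>\<^sub>M config_space \<and>
     (\<forall>A\<in>sets borel. (\<lambda>\<omega>. npts (\<zeta> \<omega>) A) \<in> \<Omega> \<rightarrow>\<^sub>M count_space UNIV) \<and>
     (\<forall>A\<in>sets borel. \<forall>k.
        measure \<Omega> {\<omega>\<in>space \<Omega>. npts (\<zeta> \<omega>) A = k}
          = measure M A ^ k / fact k * exp (- measure M A)) \<and>
     (\<forall>(n::nat) A. (\<forall>i<n. A i \<in> sets borel) \<and> disjoint_family_on A {..<n} \<longrightarrow>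
        prob_space.indep_vars \<Omega> (\<lambda>_. count_space UNIV) (\<lambda>i \<omega>. npts (\<zeta> \<omega>) (A i)) {..<n})"

text \<open>
  Independent thinning of a fixed configuration: one independent Bernoulli trial for each point,
  counted with multiplicity. The two lemmas show that the fold is well-behaved.
\<close>

definition thin_step :: "real \<Rightarrow> 'a \<Rightarrow> 'a multiset pmf \<Rightarrow> 'a multiset pmf" where
  "thin_step p x D =
     bind_pmf (bernoulli_pmf p) (\<lambda>b. map_pmf (\<lambda>\<psi>. if b then add_mset x \<psi> else \<psi>) D)"

definition thin_pmf :: "real \<Rightarrow> 'a multiset \<Rightarrow> 'a multiset pmf" where
  "thin_pmf p \<phi> = fold_mset (thin_step p) (return_pmf {#}) \<phi>"

lemma thin_pmf_empty: "thin_pmf p {#} = return_pmf {#}"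
  by (simp add: thin_pmf_def)

lemma thin_pmf_add_mset: "thin_pmf p (add_mset x \<phi>) = thin_step p x (thin_pmf p \<phi>)"
proof -
  have *: "thin_step p x (thin_step p y D) = thin_step p y (thin_step p x D)"
    for x y and D :: "'a multiset pmf"
  proof -
    have "thin_step p x (thin_step p y D) =
      bind_pmf (bernoulli_pmf p) (\<lambda>b. bind_pmf (bernoulli_pmf p) (\<lambda>c.
        map_pmf (\<lambda>\<psi>. (if b then {#x#} else {#}) + ((if c then {#y#} else {#}) + \<psi>)) D))"
      for x y
      unfolding thin_step_def map_bind_pmf pmf.map_comp
      by (intro bind_pmf_cong refl pmf.map_cong0) auto
    note this[of x y] this[of y x]
    then show ?thesis
      by (subst (asm) bind_commute_pmf) (simp add: add.left_commute)
  qed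
  interpret comp_fun_commute "thin_step p :: 'a \<Rightarrow> _"
    by standard (simp add: fun_eq_iff *)
  show ?thesis by (simp add: thin_pmf_def)
qed

definition thin_law :: "real \<Rightarrow> 'a::metric_space multiset \<Rightarrow> 'a multiset measure" where
  "thin_law p \<phi> = distr (measure_pmf (thin_pmf p \<phi>)) config_space (\<lambda>\<psi>. \<psi>)"

text \<open>
  The law of \<open>G\<^sub>t(\<phi>)\<close>, where \<open>Q\<close> is the law of \<open>\<zeta>\<close>: the superposition of a thinning of \<open>\<phi>\<close> and
  an independent thinning of a random configuration with law \<open>Q\<close>.
\<close>

definition glauber_law ::
  "'a::metric_space multiset measure \<Rightarrow> real \<Rightarrow> 'a multiset \<Rightarrow> 'a multiset measure" where
  "glauber_law Q t \<phi> =
     distr (thin_law (exp (- t)) \<phi> \<Otimes>\<^sub>M (Q \<bind> thin_law (1 - exp (- t))))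
       config_space (\<lambda>(\<mu>, \<nu>). \<mu> + \<nu>)"

definition glauber_semigroup ::
  "'a::metric_space multiset measure \<Rightarrow> real \<Rightarrow> ('a multiset \<Rightarrow> real) \<Rightarrow> 'a multiset \<Rightarrow> real" where
  "glauber_semigroup Q t F \<phi> = (\<integral>\<psi>. F \<psi> \<partial>glauber_law Q t \<phi>)"

text \<open>
  \<open>P\<^sub>t\<close> is meaningful for \<open>t \<ge> 0\<close> only, so the derivative at \<open>0\<close> is one-sided. The value of
  \<open>glauber_generator\<close> is arbitrary where \<open>in_generator_domain\<close> fails.
\<close>

definition in_generator_domain ::
  "'a::metric_space multiset measure \<Rightarrow> ('a multiset \<Rightarrow> real) \<Rightarrow> 'a multiset \<Rightarrow> bool" where
  "in_generator_domain Q F \<phi> \<longleftrightarrow>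
     (\<lambda>t. glauber_semigroup Q t F \<phi>) differentiable (at 0 within {0..})"

definition glauber_generator ::
  "'a::metric_space multiset measure \<Rightarrow> ('a multiset \<Rightarrow> real) \<Rightarrow> 'a multiset \<Rightarrow> real" where
  "glauber_generator Q F \<phi> =
     vector_derivative (\<lambda>t. glauber_semigroup Q t F \<phi>) (at 0 within {0..})"

end

theory Submission
  imports Defs
begin

text \<open>
  A law on the configuration space is determined by its generating functional
  \<open>u \<mapsto> E [\<Prod>x\<in>\<psi>. u x]\<close>, where \<open>u\<close> is simple with values in \<open>[0, 1]\<close> and equal to \<open>1\<close> off a relatively
  compact set. Thinning with probability \<open>p\<close> replaces \<open>u\<close> by \<open>1 - p + p u\<close>, superposition multiplies the
  functionals, and a Poisson process has functional \<open>exp (- \<integral>(1 - u) dM)\<close>; hence \<open>P\<^sub>t P\<^sub>s = P\<^sub>t\<^sub>+\<^sub>s\<close> and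
  \<open>L P\<^sub>s F(\<phi>)\<close> is the right derivative at \<open>s\<close> of \<open>t \<mapsto> P\<^sub>t F(\<phi>)\<close>.

  Conditionally on \<open>\<zeta> = \<xi>\<close>, the quantity \<open>P\<^sub>t F(\<phi>)\<close> is a polynomial in \<open>e\<^sup>-\<^sup>t\<close> whose derivative is, as in
  Russo's formula, a sum over the points of \<open>\<phi>\<close> and \<open>\<xi>\<close> of increments of \<open>F\<close>. For Lipschitz \<open>F\<close> it is
  bounded by \<open>(|\<phi>| + |\<xi>|) e\<^sup>-\<^sup>t\<close>, so one may differentiate under the expectation over \<open>\<zeta>\<close>, the derivative
  is integrable on the half-line, and \<open>P\<^sub>t F(\<phi>)\<close> tends to \<open>E F(\<zeta>)\<close>.
\<close>

section \<open>Generating functionals\<close>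

text \<open>Finite range makes \<open>gen_fun u\<close> a finite product of powers of counts. The
  condition on \<open>{x. u x \<noteq> 1}\<close> confines the relevant counts to relatively compact
  sets, the ones that generate \<open>config_space\<close>.\<close>

definition test_funs :: "('a::metric_space \<Rightarrow> real) set" where
  "test_funs = {u \<in> borel_measurable borel. finite (range u) \<and> (\<forall>x. 0 \<le> u x \<and> u x \<le> 1)
      \<and> compact (closure {x. u x \<noteq> 1})}"

definition gen_fun :: "('a \<Rightarrow> real) \<Rightarrow> 'a multiset \<Rightarrow> real" where
  "gen_fun u \<psi> = (\<Prod>x\<in>#\<psi>. u x)"

section \<open>Algebra of counts and generating functionals\<close>

lemma npts_empty [simp]: "npts {#} A = 0"
  by (simp add: npts_def)

lemma npts_add_mset [simp]: "npts (add_mset x \<psi>) A = (if x \<in> A then 1 else 0) + npts \<psi> A"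
  by (simp add: npts_def)

lemma npts_union [simp]: "npts (\<mu> + \<nu>) A = npts \<mu> A + npts \<nu> A"
  by (simp add: npts_def)

lemma npts_UNIV [simp]: "npts \<psi> UNIV = size \<psi>"
  by (simp add: npts_def)

lemma gen_fun_empty [simp]: "gen_fun u {#} = 1"
  by (simp add: gen_fun_def)

lemma gen_fun_add_mset [simp]: "gen_fun u (add_mset x \<psi>) = u x * gen_fun u \<psi>"
  by (simp add: gen_fun_def)

lemma gen_fun_union [simp]: "gen_fun u (\<mu> + \<nu>) = gen_fun u \<mu> * gen_fun u \<nu>"
  by (simp add: gen_fun_def)

lemma gen_fun_one [simp]: "gen_fun (\<lambda>_. 1) = (\<lambda>_. 1)"
  by (simp add: gen_fun_def fun_eq_iff)

lemma gen_fun_times: "gen_fun (\<lambda>x. u x * v x) \<psi> = gen_fun u \<psi> * gen_fun v \<psi>"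
  by (induction \<psi>) auto

lemma gen_fun_power_npts: "gen_fun (\<lambda>x. if x \<in> A then z else 1) \<psi> = z ^ npts \<psi> A"
  by (induction \<psi>) auto

text \<open>Points are grouped by the level sets of \<open>u\<close>. Both the measurability of the
  functional and its value for a Poisson process are read off from this product.\<close>

lemma gen_fun_conv_prod:
  assumes "finite (range u)"
  shows "gen_fun u \<psi> = (\<Prod>y\<in>range u. y ^ npts \<psi> (u -` {y}))"
proof (induction \<psi>)
  case (add x \<psi>)
  have "(\<Prod>y\<in>range u. y ^ (if x \<in> u -` {y} then 1 else 0)) = (\<Prod>y\<in>range u. if y = u x then y else 1)"
    by (intro prod.cong) auto
  also have "\<dots> = u x"
    using assms by (simp add: prod.delta)
  finally show ?case
    using add by (simp add: power_add prod.distrib del: vimage_singleton_eq)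
qed auto

lemma gen_fun_bounds:
  assumes "u \<in> test_funs"
  shows "0 \<le> gen_fun u \<psi>" "gen_fun u \<psi> \<le> 1" "\<bar>gen_fun u \<psi>\<bar> \<le> 1"
proof -
  have u: "0 \<le> u x" "u x \<le> 1" for x
    using assms by (auto simp: test_funs_def)
  have "0 \<le> gen_fun u \<psi> \<and> gen_fun u \<psi> \<le> 1"
    by (induction \<psi>) (auto intro!: mult_nonneg_nonneg mult_le_one u)
  then show "0 \<le> gen_fun u \<psi>" "gen_fun u \<psi> \<le> 1" "\<bar>gen_fun u \<psi>\<bar> \<le> 1"
    by auto
qed

lemma compact_closure_subset:
  fixes A B :: "'a::metric_space set"
  assumes "compact (closure B)" "A \<subseteq> B"
  shows "compact (closure A)"
  by (metis assms closed_closure closure_mono compact_Int_closed inf.absorb_iff2)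

section \<open>Closure properties of the test functions\<close>

lemma test_funs_one: "(\<lambda>_. 1) \<in> test_funs"
  by (simp add: test_funs_def)

lemma test_funs_if:
  assumes "A \<in> sets borel" "compact (closure A)" "0 \<le> z" "z \<le> 1"
  shows "(\<lambda>x. if x \<in> A then z else 1) \<in> test_funs"
proof -
  have "range (\<lambda>x. if x \<in> A then z else 1) \<subseteq> {z, 1}"
    by auto
  then have "finite (range (\<lambda>x. if x \<in> A then z else 1))"
    by (rule finite_subset) simp
  moreover have "compact (closure {x. (if x \<in> A then z else 1) \<noteq> 1})"
    by (rule compact_closure_subset[OF assms(2)]) auto
  ultimately show ?thesis
    using assms by (auto simp: test_funs_def)
qed

lemma test_funs_times:
  assumes "u \<in> test_funs" "v \<in> test_funs"
  shows "(\<lambda>x. u x * v x) \<in> test_funs"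
proof -
  have "range (\<lambda>x. u x * v x) \<subseteq> (\<lambda>(a, b). a * b) ` (range u \<times> range v)"
    by auto
  then have "finite (range (\<lambda>x. u x * v x))"
    by (rule finite_subset) (use assms in \<open>auto simp: test_funs_def\<close>)
  moreover have "compact (closure ({x. u x \<noteq> 1} \<union> {x. v x \<noteq> 1}))"
    using assms by (auto simp: test_funs_def compact_Un)
  then have "compact (closure {x. u x * v x \<noteq> 1})"
    by (rule compact_closure_subset) auto
  ultimately show ?thesis
    using assms by (auto simp: test_funs_def intro!: mult_le_one)
qed

section \<open>Measurability of counts and functionals\<close>

lemma space_config_space [simp]: "space config_space = UNIV"
  by (simp add: config_space_def)

lemma measurable_npts [measurable]:
  assumes "A \<in> sets borel" "compact (closure A)"
  shows "(\<lambda>\<psi>. npts \<psi> A) \<in> config_space \<rightarrow>\<^sub>M count_space UNIV"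
  by (rule measurableI) (use assms in \<open>auto simp: config_space_def intro!: sigma_sets.Basic\<close>)

lemma borel_measurable_gen_fun [measurable]:
  assumes "u \<in> test_funs"
  shows "gen_fun u \<in> borel_measurable config_space"
proof -
  have fin: "finite (range u)"
    using assms by (simp add: test_funs_def)
  have "(\<lambda>\<psi>. y ^ npts \<psi> (u -` {y})) \<in> borel_measurable config_space" for y
  \<comment> \<open>The level set of the value 1 need not be relatively compact, but its factor is
    constantly 1; every other level set lies inside \<open>{x. u x \<noteq> 1}\<close>.\<close>
  proof (cases "y = 1")
    case False
    have "u \<in> borel_measurable borel"
      using assms by (simp add: test_funs_def)
    from measurable_sets[OF this, of "{y}"] have "u -` {y} \<in> sets borel"
      by simp
    moreover have "compact (closure (u -` {y}))"
      by (rule compact_closure_subset[of "{x. u x \<noteq> 1}"])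
        (use assms False in \<open>auto simp: test_funs_def\<close>)
    ultimately have "(\<lambda>\<psi>. npts \<psi> (u -` {y})) \<in> config_space \<rightarrow>\<^sub>M count_space UNIV"
      by (rule measurable_npts)
    then show ?thesis
      by (rule measurable_compose) simp
  qed simp
  then show ?thesis
    unfolding gen_fun_conv_prod[OF fin, abs_def] by (rule borel_measurable_prod)
qed

text \<open>
  The functionals \<open>gen_fun u\<close> are multiplicative in \<open>u\<close>, so this is a functional monotone class
  theorem. Indicators of \<open>{\<psi>. npts \<psi> A = k}\<close> are extracted from the powers \<open>z ^ npts \<psi> A\<close> by
  letting \<open>z\<close> tend to \<open>0\<close> in \<open>(z ^ n - (\<Sum>j<k. z ^ j * of_bool (n = j))) / z ^ k\<close>.
\<close>

lemma config_monotone_class: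
  fixes H :: "('a::metric_space multiset \<Rightarrow> real) \<Rightarrow> bool"
  assumes gen: "\<And>u. u \<in> test_funs \<Longrightarrow> H (gen_fun u)"
    and lin: "\<And>f g a b. H f \<Longrightarrow> H g \<Longrightarrow> H (\<lambda>\<psi>. a * f \<psi> + b * g \<psi>)"
    and lim: "\<And>f g C. (\<And>n::nat. H (f n)) \<Longrightarrow> (\<And>n \<psi>. \<bar>f n \<psi>\<bar> \<le> C) \<Longrightarrow>
        (\<And>\<psi>. (\<lambda>n. f n \<psi>) \<longlonglongrightarrow> g \<psi>) \<Longrightarrow> H g"
    and S: "S \<in> sets config_space"
  shows "H (indicator S)"
proof -
  have H1: "H (\<lambda>_. 1)"
    using gen[OF test_funs_one] by simp
  have H0: "H (\<lambda>_. 0)"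
    using lin[OF H1 H1, of 0 0] by simp
  have Hsum: "H (\<lambda>\<psi>. \<Sum>i<n. f i \<psi>)" if "\<And>i. i < n \<Longrightarrow> H (f i)" for n :: nat and f
    using that
  proof (induction n)
    case (Suc n)
    then show ?case
      using lin[of "\<lambda>\<psi>. \<Sum>i<n. f i \<psi>" "f n" 1 1] by simp
  qed (simp add: H0)
  \<comment> \<open>Constraints are kept in a list so that intersecting cylinders is appending
    lists; repeated or contradictory constraints do no harm.\<close>
  define cyl :: "('a set \<times> nat) list \<Rightarrow> 'a multiset set" where
    "cyl L = {\<psi>. \<forall>(A, k)\<in>set L. npts \<psi> A = k}" for L
  define ok :: "('a set \<times> nat) list \<Rightarrow> bool" where
    "ok L \<longleftrightarrow> (\<forall>(A, k)\<in>set L. A \<in> sets borel \<and> compact (closure A))" for L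
  \<comment> \<open>The factor \<open>gen_fun u\<close> strengthens the induction: the power
    \<open>z n ^ npts \<psi> A\<close> is itself a functional and is absorbed into \<open>u\<close>
    when the hypothesis for \<open>L\<close> is applied.\<close>
  have cyl: "H (\<lambda>\<psi>. indicator (cyl L) \<psi> * gen_fun u \<psi>)"
    if "ok L" "u \<in> test_funs" for L u
    using that
  proof (induction L arbitrary: u)
    case Nil
    then show ?case using gen by (simp add: cyl_def)
  next
    case (Cons Ak L)
    obtain A k where Ak: "Ak = (A, k)" by force
    from Cons.prems have A: "A \<in> sets borel" "compact (closure A)" and L: "ok L"
      by (auto simp: ok_def Ak)
    have "H (\<lambda>\<psi>. indicator (cyl L) \<psi> * gen_fun u \<psi> * of_bool (npts \<psi> A = k))" for k
    proof (induction k rule: less_induct)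
      case (less k)
      define z where "z n = inverse (real (Suc n))" for n
      have z: "0 < z n" "z n \<le> 1" for n
        by (auto simp: z_def field_simps)
      define X where "X \<psi> = indicator (cyl L) \<psi> * gen_fun u \<psi>" for \<psi>
      have X: "0 \<le> X \<psi>" "X \<psi> \<le> 1" for \<psi>
        using gen_fun_bounds[OF Cons.prems(2)] by (auto simp: X_def indicator_def)
      \<comment> \<open>The quotient is written with the terms below \<open>k\<close> already
        cancelled, so that the bound by 1 is visible in spite of the division by
        \<open>z n ^ k\<close>.\<close>
      define f where "f n \<psi> = (if npts \<psi> A < k then 0 else X \<psi> * z n ^ (npts \<psi> A - k))" for n \<psi>
      have "H (f n)" for n
      proof -
        have "H (\<lambda>\<psi>. indicator (cyl L) \<psi> * gen_fun (\<lambda>x. u x * (if x \<in> A then z n else 1)) \<psi>)"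
          by (intro Cons.IH L test_funs_times Cons.prems test_funs_if A z less_imp_le)
        then have 1: "H (\<lambda>\<psi>. X \<psi> * z n ^ npts \<psi> A)"
          by (simp add: gen_fun_times gen_fun_power_npts X_def mult.assoc)
        have 2: "H (\<lambda>\<psi>. \<Sum>j<k. z n ^ j * (X \<psi> * of_bool (npts \<psi> A = j)))"
        proof (rule Hsum)
          fix j assume "j < k"
          then have "H (\<lambda>\<psi>. X \<psi> * of_bool (npts \<psi> A = j))"
            using less.IH by (simp add: X_def)
          from lin[OF this this, of "z n ^ j" 0]
          show "H (\<lambda>\<psi>. z n ^ j * (X \<psi> * of_bool (npts \<psi> A = j)))" by simp
        qed
        have "f n = (\<lambda>\<psi>. inverse (z n ^ k) * (X \<psi> * z n ^ npts \<psi> A)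
            + (- inverse (z n ^ k)) * (\<Sum>j<k. z n ^ j * (X \<psi> * of_bool (npts \<psi> A = j))))"
        proof
          fix \<psi>
          have "(\<Sum>j<k. z n ^ j * (X \<psi> * of_bool (npts \<psi> A = j)))
              = (\<Sum>j<k. if j = npts \<psi> A then z n ^ j * X \<psi> else 0)"
            by (intro sum.cong) auto
          also have "\<dots> = (if npts \<psi> A < k then z n ^ npts \<psi> A * X \<psi> else 0)"
            by (simp add: sum.delta)
          finally have *: "(\<Sum>j<k. z n ^ j * (X \<psi> * of_bool (npts \<psi> A = j)))
            = (if npts \<psi> A < k then z n ^ npts \<psi> A * X \<psi> else 0)" .
          have "z n ^ npts \<psi> A = z n ^ k * z n ^ (npts \<psi> A - k)" if "\<not> npts \<psi> A < k"
            using that by (simp flip: power_add)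
          then show "f n \<psi> = inverse (z n ^ k) * (X \<psi> * z n ^ npts \<psi> A)
            + (- inverse (z n ^ k)) * (\<Sum>j<k. z n ^ j * (X \<psi> * of_bool (npts \<psi> A = j)))"
            using z(1)[of n] unfolding * by (auto simp: f_def field_simps)
        qed
        then show ?thesis
          using lin[OF 1 2, of "inverse (z n ^ k)" "- inverse (z n ^ k)"] by simp
      qed
      moreover have "\<bar>f n \<psi>\<bar> \<le> 1" for n \<psi>
        using X[of \<psi>] z[of n]
        by (auto simp: f_def abs_mult power_abs intro!: mult_le_one power_le_one)
      moreover have "(\<lambda>n. f n \<psi>) \<longlonglongrightarrow> X \<psi> * of_bool (npts \<psi> A = k)" for \<psi>
      proof (cases "npts \<psi> A > k")
        case True
        have "z \<longlonglongrightarrow> 0"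
          unfolding z_def by (rule LIMSEQ_inverse_real_of_nat)
        then have "(\<lambda>n. X \<psi> * z n ^ (npts \<psi> A - k)) \<longlonglongrightarrow> X \<psi> * 0 ^ (npts \<psi> A - k)"
          by (intro tendsto_intros)
        then show ?thesis
          using True by (simp add: f_def power_0_left)
      qed (auto simp: f_def)
      ultimately have "H (\<lambda>\<psi>. X \<psi> * of_bool (npts \<psi> A = k))"
        by (rule lim)
      then show ?case by (simp add: X_def)
    qed
    moreover have "indicator (cyl (Ak # L)) \<psi> * gen_fun u \<psi>
        = indicator (cyl L) \<psi> * gen_fun u \<psi> * of_bool (npts \<psi> A = k)" for \<psi>
      by (auto simp: cyl_def Ak indicator_def)
    ultimately show ?case by (simp only:)
  qed
  define G where "G = {cyl L | L. ok L}"
  have gens: "{(\<lambda>\<psi>. npts \<psi> A) -` B | A B. A \<in> sets borel \<and> compact (closure A)} \<subseteq> sigma_sets UNIV G"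
  proof safe
    fix A :: "'a set" and B assume A: "A \<in> sets borel" "compact (closure A)"
    have "(\<lambda>\<psi>. npts \<psi> A) -` B = (\<Union>k\<in>B. cyl [(A, k)])"
      by (auto simp: cyl_def)
    also have "\<dots> \<in> sigma_sets UNIV G"
    proof (rule sigma_algebra.countable_UN'')
      show "sigma_algebra UNIV (sigma_sets UNIV G)"
        by (rule sigma_algebra_sigma_sets) simp
      show "cyl [(A, k)] \<in> sigma_sets UNIV G" for k
        by (rule sigma_sets.Basic) (use A in \<open>auto simp: G_def ok_def\<close>)
    qed simp
    finally show "(\<lambda>\<psi>. npts \<psi> A) -` B \<in> sigma_sets UNIV G" .
  qed
  have SG: "S \<in> sigma_sets UNIV G"
    using S sigma_sets_mono[OF gens] by (auto simp: config_space_def)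
  have "Int_stable G"
  proof (rule Int_stableI)
    fix a b assume "a \<in> G" "b \<in> G"
    then obtain L L' where "a = cyl L" "b = cyl L'" "ok L" "ok L'" by (auto simp: G_def)
    moreover have "cyl L \<inter> cyl L' = cyl (L @ L')"
      by (auto simp: cyl_def ball_Un)
    moreover have "ok (L @ L')"
      using \<open>ok L\<close> \<open>ok L'\<close> by (auto simp: ok_def)
    ultimately show "a \<inter> b \<in> G"
      by (auto simp: G_def)
  qed
  moreover have "G \<subseteq> Pow UNIV"
    by simp
  ultimately show ?thesis
    using SG
  proof (induction rule: sigma_sets_induct_disjoint)
    case (basic A)
    then obtain L where "A = cyl L" "ok L" by (auto simp: G_def)
    with cyl[OF this(2) test_funs_one] show ?case by simp
  next
    case empty
    have "indicator {} = (\<lambda>_::'a multiset. 0::real)" by auto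
    then show ?case using H0 by simp
  next
    case (compl A)
    have "indicator (UNIV - A) = (\<lambda>\<psi>. 1 * 1 + (-1) * indicator A \<psi> :: real)"
      by (auto simp: indicator_def)
    then show ?case using lin[OF H1 compl(2), of 1 "-1"] by simp
  next
    case (union A)
    have sums: "(\<lambda>i. indicator (A i) \<psi>) sums (indicator (\<Union>i. A i) \<psi> :: real)" for \<psi>
      by (rule indicator_sums) (use union in \<open>auto simp: disjoint_family_on_def\<close>)
    show ?case
    proof (rule lim[where f = "\<lambda>n \<psi>. \<Sum>i<n. indicator (A i) \<psi>" and C = 1])
      show "H (\<lambda>\<psi>. \<Sum>i<n. indicator (A i) \<psi>)" for n
        using union by (intro Hsum) auto
      show "(\<lambda>n. \<Sum>i<n. indicator (A i) \<psi>) \<longlonglongrightarrow> (indicator (\<Union> (range A)) \<psi> :: real)" for \<psi>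
        using sums by (simp add: sums_def)
      have "(\<Sum>i<n. indicator (A i) \<psi>) \<le> (\<Sum>i. indicator (A i) \<psi> :: real)" for n \<psi>
        by (rule sum_le_suminf) (use sums in \<open>auto simp: sums_iff\<close>)
      also have "(\<Sum>i. indicator (A i) \<psi> :: real) \<le> 1" for \<psi>
        using sums[of \<psi>] by (auto simp: sums_iff indicator_def)
      finally show "\<bar>\<Sum>i<n. indicator (A i) \<psi>\<bar> \<le> (1::real)" for n \<psi>
        by (simp add: sum_nonneg)
    qed
  qed
qed

text \<open>Properties stated through integrals are linear and closed under limits only for
  integrable functions. Measurability and boundedness are therefore carried along inside
  \<open>H'\<close>, and the closure conditions may assume them.\<close>

lemma config_monotone_class_bounded:
  fixes H :: "('a::metric_space multiset \<Rightarrow> real) \<Rightarrow> bool"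
  assumes gen: "\<And>u. u \<in> test_funs \<Longrightarrow> H (gen_fun u)"
    and lin: "\<And>f g a b C D. f \<in> borel_measurable config_space \<Longrightarrow> g \<in> borel_measurable config_space \<Longrightarrow>
        (\<And>\<psi>. \<bar>f \<psi>\<bar> \<le> C) \<Longrightarrow> (\<And>\<psi>. \<bar>g \<psi>\<bar> \<le> D) \<Longrightarrow> H f \<Longrightarrow> H g \<Longrightarrow> H (\<lambda>\<psi>. a * f \<psi> + b * g \<psi>)"
    and lim: "\<And>f g C. (\<And>n::nat. f n \<in> borel_measurable config_space) \<Longrightarrow> g \<in> borel_measurable config_space \<Longrightarrow>
        (\<And>n \<psi>. \<bar>f n \<psi>\<bar> \<le> C) \<Longrightarrow> (\<And>n. H (f n)) \<Longrightarrow> (\<And>\<psi>. (\<lambda>n. f n \<psi>) \<longlonglongrightarrow> g \<psi>) \<Longrightarrow> H g"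
    and S: "S \<in> sets config_space"
  shows "H (indicator S)"
proof -
  define H' where "H' f \<longleftrightarrow> f \<in> borel_measurable config_space \<and> (\<exists>C. \<forall>\<psi>. \<bar>f \<psi>\<bar> \<le> C) \<and> H f"
    for f :: "'a multiset \<Rightarrow> real"
  have "H' (indicator S)"
  proof (rule config_monotone_class[OF _ _ _ S])
    show "H' (gen_fun u)" if "u \<in> test_funs" for u
      using that gen_fun_bounds(3)[OF that] by (auto simp: H'_def gen intro!: exI[of _ 1])
    show "H' (\<lambda>\<psi>. a * f \<psi> + b * g \<psi>)" if fg: "H' f" "H' g" for f g a b
    proof -
      from fg obtain C D where CD: "\<And>\<psi>. \<bar>f \<psi>\<bar> \<le> C" "\<And>\<psi>. \<bar>g \<psi>\<bar> \<le> D"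
        unfolding H'_def by blast
      have "\<bar>a * f \<psi> + b * g \<psi>\<bar> \<le> \<bar>a\<bar> * C + \<bar>b\<bar> * D" for \<psi>
        by (rule order_trans[OF abs_triangle_ineq])
          (auto simp: abs_mult intro!: add_mono mult_left_mono CD)
      then have "\<exists>C. \<forall>\<psi>. \<bar>a * f \<psi> + b * g \<psi>\<bar> \<le> C"
        by blast
      moreover have fg': "f \<in> borel_measurable config_space" "g \<in> borel_measurable config_space" "H f" "H g"
        using fg by (simp_all add: H'_def)
      ultimately show ?thesis
        using lin[OF fg'(1,2) CD fg'(3,4)] by (simp add: H'_def)
    qed
    show "H' g" if f: "\<And>n. H' (f n)" "\<And>n \<psi>. \<bar>f n \<psi>\<bar> \<le> C" and g: "\<And>\<psi>. (\<lambda>n. f n \<psi>) \<longlonglongrightarrow> g \<psi>"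
      for f g C
    proof -
      have fm: "f n \<in> borel_measurable config_space" and Hf: "H (f n)" for n
        using f(1) by (simp_all add: H'_def)
      have gm: "g \<in> borel_measurable config_space"
        using g fm by (rule borel_measurable_LIMSEQ_real)
      have "\<bar>g \<psi>\<bar> \<le> C" for \<psi>
        by (rule LIMSEQ_le_const2[OF tendsto_rabs[OF g]]) (use f in auto)
      then have "\<exists>C. \<forall>\<psi>. \<bar>g \<psi>\<bar> \<le> C"
        by blast
      then show ?thesis
        using lim[OF fm gm f(2) Hf g] gm by (simp add: H'_def)
    qed
  qed
  then show ?thesis
    by (simp add: H'_def)
qed

text \<open>Monotone class argument for the property of having equal integrals under
  \<open>N\<close> and \<open>N'\<close>; closure under limits is dominated convergence. Equality of
  the total masses is the case \<open>u = 1\<close>.\<close>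

lemma config_measure_eqI:
  assumes "finite_measure N" "finite_measure N'"
    and sets [measurable_cong]: "sets N = sets config_space" "sets N' = sets config_space"
    and eq: "\<And>u. u \<in> test_funs \<Longrightarrow> (\<integral>\<psi>. gen_fun u \<psi> \<partial>N) = (\<integral>\<psi>. gen_fun u \<psi> \<partial>N')"
  shows "N = N'"
proof (rule measure_eqI)
  interpret N: finite_measure N by fact
  interpret N': finite_measure N' by fact
  fix S assume "S \<in> sets N"
  then have S: "S \<in> sets config_space" using sets by simp
  have int: "integrable N f" "integrable N' f"
    if [measurable]: "f \<in> borel_measurable config_space" and "\<And>\<psi>. \<bar>f \<psi>\<bar> \<le> C" for f and C :: real
    using that by (auto intro!: N.integrable_const_bound[of _ C] N'.integrable_const_bound[of _ C])
  have "(\<integral>\<psi>. indicator S \<psi> \<partial>N) = (\<integral>\<psi>. indicator S \<psi> \<partial>N' :: real)"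
  proof (rule config_monotone_class_bounded[OF _ _ _ S])
    fix f g :: "'a multiset \<Rightarrow> real" and a b C D :: real
    assume "f \<in> borel_measurable config_space" "g \<in> borel_measurable config_space"
      "\<And>\<psi>. \<bar>f \<psi>\<bar> \<le> C" "\<And>\<psi>. \<bar>g \<psi>\<bar> \<le> D"
    then have "integrable N f" "integrable N g" "integrable N' f" "integrable N' g"
      using int by blast+
    moreover assume "(\<integral>\<psi>. f \<psi> \<partial>N) = (\<integral>\<psi>. f \<psi> \<partial>N')" "(\<integral>\<psi>. g \<psi> \<partial>N) = (\<integral>\<psi>. g \<psi> \<partial>N')"
    ultimately show "(\<integral>\<psi>. a * f \<psi> + b * g \<psi> \<partial>N) = (\<integral>\<psi>. a * f \<psi> + b * g \<psi> \<partial>N')"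
      by simp
  next
    fix f :: "nat \<Rightarrow> 'a multiset \<Rightarrow> real" and g :: "'a multiset \<Rightarrow> real" and C :: real
    assume [measurable]: "\<And>n. f n \<in> borel_measurable config_space" "g \<in> borel_measurable config_space"
      and f: "\<And>n \<psi>. \<bar>f n \<psi>\<bar> \<le> C" "\<And>n. (\<integral>\<psi>. f n \<psi> \<partial>N) = (\<integral>\<psi>. f n \<psi> \<partial>N')"
      and g: "\<And>\<psi>. (\<lambda>n. f n \<psi>) \<longlonglongrightarrow> g \<psi>"
    have "(\<lambda>n. \<integral>\<psi>. f n \<psi> \<partial>N) \<longlonglongrightarrow> (\<integral>\<psi>. g \<psi> \<partial>N)"
      by (rule integral_dominated_convergence[where w = "\<lambda>_. C"]) (use f g in auto)
    moreover have "(\<lambda>n. \<integral>\<psi>. f n \<psi> \<partial>N') \<longlonglongrightarrow> (\<integral>\<psi>. g \<psi> \<partial>N')"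
      by (rule integral_dominated_convergence[where w = "\<lambda>_. C"]) (use f g in auto)
    ultimately show "(\<integral>\<psi>. g \<psi> \<partial>N) = (\<integral>\<psi>. g \<psi> \<partial>N')"
      unfolding f(2) by (rule LIMSEQ_unique)
  qed (rule eq)
  then show "emeasure N S = emeasure N' S"
    using S by (simp add: N.emeasure_eq_measure N'.emeasure_eq_measure
        sets_eq_imp_space_eq[OF sets(1)] sets_eq_imp_space_eq[OF sets(2)])
qed (use sets in simp)

text \<open>The same argument for the property that the integral depends measurably on the
  parameter. It reduces the measurability of a kernel to that of its explicit generating
  functional.\<close>

lemma config_kernel_measurable:
  assumes prob: "\<And>x. prob_space (K x)"
    and sets: "\<And>x. sets (K x) = sets config_space"
    and gen: "\<And>u. u \<in> test_funs \<Longrightarrow> (\<lambda>x. \<integral>\<psi>. gen_fun u \<psi> \<partial>K x) \<in> borel_measurable N"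
  shows "K \<in> N \<rightarrow>\<^sub>M subprob_algebra config_space"
proof (rule measurable_subprob_algebra)
  show "subprob_space (K x)" for x
    by (rule prob_space_imp_subprob_space) (rule prob)
next
  fix S :: "'b multiset set" assume S: "S \<in> sets config_space"
  interpret K: prob_space "K x" for x by (rule prob)
  note [measurable_cong] = sets
  have int: "integrable (K x) f"
    if [measurable]: "f \<in> borel_measurable config_space" and "\<And>\<psi>. \<bar>f \<psi>\<bar> \<le> C" for f x and C :: real
    using that by (auto intro!: K.integrable_const_bound[of _ C])
  have "(\<lambda>x. \<integral>\<psi>. indicator S \<psi> \<partial>K x :: real) \<in> borel_measurable N"
  proof (rule config_monotone_class_bounded[OF _ _ _ S])
    fix f g :: "'b multiset \<Rightarrow> real" and a b C D :: real
    assume "f \<in> borel_measurable config_space" "g \<in> borel_measurable config_space"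
      "\<And>\<psi>. \<bar>f \<psi>\<bar> \<le> C" "\<And>\<psi>. \<bar>g \<psi>\<bar> \<le> D"
    then have "integrable (K x) f" "integrable (K x) g" for x
      using int by blast+
    moreover assume "(\<lambda>x. \<integral>\<psi>. f \<psi> \<partial>K x) \<in> borel_measurable N" "(\<lambda>x. \<integral>\<psi>. g \<psi> \<partial>K x) \<in> borel_measurable N"
    ultimately show "(\<lambda>x. \<integral>\<psi>. a * f \<psi> + b * g \<psi> \<partial>K x) \<in> borel_measurable N"
      by simp
  next
    fix f :: "nat \<Rightarrow> 'b multiset \<Rightarrow> real" and g :: "'b multiset \<Rightarrow> real" and C :: real
    assume [measurable]: "\<And>n. f n \<in> borel_measurable config_space" "g \<in> borel_measurable config_space"
      and f: "\<And>n \<psi>. \<bar>f n \<psi>\<bar> \<le> C" "\<And>n. (\<lambda>x. \<integral>\<psi>. f n \<psi> \<partial>K x) \<in> borel_measurable N"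
      and g: "\<And>\<psi>. (\<lambda>n. f n \<psi>) \<longlonglongrightarrow> g \<psi>"
    have "(\<lambda>n. \<integral>\<psi>. f n \<psi> \<partial>K x) \<longlonglongrightarrow> (\<integral>\<psi>. g \<psi> \<partial>K x)" for x
      by (rule integral_dominated_convergence[where w = "\<lambda>_. C"]) (use f g in auto)
    then show "(\<lambda>x. \<integral>\<psi>. g \<psi> \<partial>K x) \<in> borel_measurable N"
      using f(2) by (rule borel_measurable_LIMSEQ_real)
  qed (rule gen)
  then show "(\<lambda>x. emeasure (K x) S) \<in> borel_measurable N"
    using S by (simp add: K.emeasure_eq_measure sets_eq_imp_space_eq[OF sets])
qed (rule sets)


section \<open>Thinning\<close>

text \<open>The mean contribution of a point at \<open>x\<close> after thinning: \<open>u x\<close>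
  if it is kept, 1 if it is deleted.\<close>

definition thin_fun :: "real \<Rightarrow> ('a \<Rightarrow> real) \<Rightarrow> 'a \<Rightarrow> real" where
  "thin_fun p u x = 1 - p + p * u x"

lemma test_funs_thin_fun:
  assumes "u \<in> test_funs" "0 \<le> p" "p \<le> 1"
  shows "thin_fun p u \<in> test_funs"
proof -
  have "range (\<lambda>x. 1 - p + p * u x) = (\<lambda>y. 1 - p + p * y) ` range u"
    by auto
  then have "finite (range (\<lambda>x. 1 - p + p * u x))"
    using assms by (auto simp: test_funs_def)
  moreover have "compact (closure {x. 1 - p + p * u x \<noteq> 1})"
    by (rule compact_closure_subset[of "{x. u x \<noteq> 1}"]) (use assms in \<open>auto simp: test_funs_def\<close>)
  moreover have "0 \<le> 1 - p + p * u x \<and> 1 - p + p * u x \<le> 1" for x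
  proof -
    have "0 \<le> p * u x" "p * u x \<le> p"
      using assms by (auto simp: test_funs_def intro: mult_left_le)
    then show ?thesis using assms by auto
  qed
  ultimately show ?thesis
    using assms by (auto simp: test_funs_def thin_fun_def[abs_def])
qed

text \<open>Successive thinnings multiply the retention probabilities; this is the algebra behind
  the semigroup property.\<close>

lemma thin_fun_thin_fun: "thin_fun p (thin_fun q u) = thin_fun (p * q) u"
  by (simp add: thin_fun_def fun_eq_iff algebra_simps)

section \<open>Thinning and superposition of discrete laws\<close>

lemma set_pmf_thin_step:
  "set_pmf (thin_step p x D) \<subseteq> set_pmf D \<union> add_mset x ` set_pmf D"
  by (auto simp: thin_step_def split: if_splits)

lemma finite_set_pmf_thin_step:
  "finite (set_pmf D) \<Longrightarrow> finite (set_pmf (thin_step p x D))"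
  by (rule finite_subset[OF set_pmf_thin_step]) simp

lemma expectation_thin_step:
  fixes f :: "'a multiset \<Rightarrow> real"
  assumes "finite (set_pmf D)" "0 \<le> p" "p \<le> 1"
  shows "measure_pmf.expectation (thin_step p x D) f =
    p * measure_pmf.expectation D (\<lambda>\<psi>. f (add_mset x \<psi>)) + (1 - p) * measure_pmf.expectation D f"
  unfolding thin_step_def
  by (subst pmf_expectation_bind[of UNIV]) (use assms in \<open>auto simp: UNIV_bool\<close>)

definition superpose_pmf :: "'a multiset pmf \<Rightarrow> 'a multiset pmf \<Rightarrow> 'a multiset pmf" where
  "superpose_pmf D E = bind_pmf D (\<lambda>\<mu>. map_pmf (\<lambda>\<nu>. \<mu> + \<nu>) E)"

lemma superpose_pmf_thin_empty [simp]: "superpose_pmf D (thin_pmf q {#}) = D"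
  by (simp add: superpose_pmf_def thin_pmf_empty bind_return_pmf')

text \<open>The coin of the new point is independent of all other draws, so it can be tossed last.
  This opens the way to induction on the thinned configuration.\<close>

lemma superpose_pmf_thin_add_mset:
  "superpose_pmf D (thin_pmf q (add_mset x \<xi>)) = thin_step q x (superpose_pmf D (thin_pmf q \<xi>))"
proof -
  have "superpose_pmf D (thin_pmf q (add_mset x \<xi>)) =
    bind_pmf D (\<lambda>\<mu>. bind_pmf (bernoulli_pmf q) (\<lambda>b.
      map_pmf (\<lambda>\<nu>. if b then add_mset x (\<mu> + \<nu>) else \<mu> + \<nu>) (thin_pmf q \<xi>)))"
    unfolding superpose_pmf_def thin_pmf_add_mset thin_step_def map_bind_pmf pmf.map_comp
    by (intro bind_pmf_cong refl pmf.map_cong0) auto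
  also have "\<dots> = bind_pmf (bernoulli_pmf q) (\<lambda>b. bind_pmf D (\<lambda>\<mu>.
      map_pmf (\<lambda>\<nu>. if b then add_mset x (\<mu> + \<nu>) else \<mu> + \<nu>) (thin_pmf q \<xi>)))"
    by (rule bind_commute_pmf)
  also have "\<dots> = thin_step q x (superpose_pmf D (thin_pmf q \<xi>))"
    unfolding superpose_pmf_def thin_step_def map_bind_pmf pmf.map_comp
    by (intro bind_pmf_cong refl pmf.map_cong0) auto
  finally show ?thesis .
qed

lemma finite_set_pmf_superpose_thin:
  "finite (set_pmf D) \<Longrightarrow> finite (set_pmf (superpose_pmf D (thin_pmf q \<xi>)))"
  by (induction \<xi>) (auto simp: superpose_pmf_thin_add_mset intro: finite_set_pmf_thin_step)

text \<open>Through this identity, facts about superpositions specialise to plain thinnings.\<close>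

lemma superpose_pmf_return_empty: "superpose_pmf (return_pmf {#}) D = (D :: 'a multiset pmf)"
proof -
  have "(\<lambda>\<nu>. {#} + \<nu>) = (id :: 'a multiset \<Rightarrow> _)" by auto
  then show ?thesis
    unfolding superpose_pmf_def bind_return_pmf by (simp only: pmf.map_id)
qed

lemma finite_set_pmf_thin: "finite (set_pmf (thin_pmf p \<phi>))"
  using finite_set_pmf_superpose_thin[of "return_pmf {#}" p \<phi>]
  by (simp add: superpose_pmf_return_empty)

lemma size_superpose_thin:
  assumes "\<And>\<psi>. \<psi> \<in> set_pmf D \<Longrightarrow> size \<psi> \<le> n" "\<psi> \<in> set_pmf (superpose_pmf D (thin_pmf q \<xi>))"
  shows "size \<psi> \<le> n + size \<xi>"
  using assms(2)
proof (induction \<xi> arbitrary: \<psi>)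
  case (add x \<xi>)
  then have "\<psi> \<in> set_pmf (superpose_pmf D (thin_pmf q \<xi>)) \<union> add_mset x ` set_pmf (superpose_pmf D (thin_pmf q \<xi>))"
    using set_pmf_thin_step by (force simp: superpose_pmf_thin_add_mset)
  then show ?case
    using add.IH by force
qed (use assms(1) in simp)

lemma size_thin: "\<psi> \<in> set_pmf (thin_pmf p \<phi>) \<Longrightarrow> size \<psi> \<le> size \<phi>"
  using size_superpose_thin[of "return_pmf {#}" 0 \<psi> p \<phi>]
  by (simp add: superpose_pmf_return_empty)

text \<open>Each point of \<open>\<xi>\<close> contributes an independent factor
  \<open>q * u x + (1 - q)\<close>, by conditioning on its coin.\<close>

lemma expectation_gen_fun_superpose_thin:
  assumes "finite (set_pmf D)" "0 \<le> q" "q \<le> 1"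
  shows "measure_pmf.expectation (superpose_pmf D (thin_pmf q \<xi>)) (gen_fun u) =
    measure_pmf.expectation D (gen_fun u) * gen_fun (thin_fun q u) \<xi>"
proof (induction \<xi>)
  case (add x \<xi>)
  then show ?case
    by (simp add: superpose_pmf_thin_add_mset expectation_thin_step finite_set_pmf_superpose_thin
        assms thin_fun_def algebra_simps)
qed simp

lemma expectation_gen_fun_thin:
  assumes "0 \<le> p" "p \<le> 1"
  shows "measure_pmf.expectation (thin_pmf p \<phi>) (gen_fun u) = gen_fun (thin_fun p u) \<phi>"
  using expectation_gen_fun_superpose_thin[of "return_pmf {#}" p \<phi> u] assms
  by (simp add: superpose_pmf_return_empty)

text \<open>Pushing forward along the identity replaces the power set, on which a pmf lives, by the
  sigma-algebra of \<open>config_space\<close>.\<close>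

definition config_law :: "'a::metric_space multiset pmf \<Rightarrow> 'a multiset measure" where
  "config_law D = distr (measure_pmf D) config_space (\<lambda>\<psi>. \<psi>)"

lemma thin_law_eq: "thin_law p \<phi> = config_law (thin_pmf p \<phi>)"
  by (simp add: thin_law_def config_law_def)

lemma sets_config_law [simp, measurable_cong]: "sets (config_law D) = sets config_space"
  by (simp add: config_law_def)

lemma prob_space_config_law: "prob_space (config_law D)"
  unfolding config_law_def by (rule prob_space.prob_space_distr) (auto simp: measure_pmf.prob_space_axioms)

lemma integral_config_law:
  fixes f :: "'a::metric_space multiset \<Rightarrow> real"
  shows "f \<in> borel_measurable config_space \<Longrightarrow> (\<integral>\<psi>. f \<psi> \<partial>config_law D) = measure_pmf.expectation D f"
  unfolding config_law_def by (subst integral_distr) auto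

lemma nn_integral_config_law:
  "f \<in> borel_measurable config_space \<Longrightarrow> (\<integral>\<^sup>+\<psi>. f \<psi> \<partial>config_law D) = (\<integral>\<^sup>+\<psi>. f \<psi> \<partial>measure_pmf D)"
  unfolding config_law_def by (subst nn_integral_distr) auto

lemma measurable_superpose_thin_law:
  fixes D :: "'a::metric_space multiset pmf"
  assumes "finite (set_pmf D)" "0 \<le> q" "q \<le> 1"
  shows "(\<lambda>\<xi>. config_law (superpose_pmf D (thin_pmf q \<xi>))) \<in> config_space \<rightarrow>\<^sub>M subprob_algebra config_space"
proof (rule config_kernel_measurable)
  fix u :: "'a \<Rightarrow> real" assume u: "u \<in> test_funs"
  note [measurable] = borel_measurable_gen_fun[OF test_funs_thin_fun[OF u assms(2,3)]]
  show "(\<lambda>\<xi>. \<integral>\<psi>. gen_fun u \<psi> \<partial>config_law (superpose_pmf D (thin_pmf q \<xi>))) \<in> borel_measurable config_space"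
    using u by (simp add: integral_config_law borel_measurable_gen_fun expectation_gen_fun_superpose_thin assms)
qed (simp_all add: prob_space_config_law)

lemma measurable_thin_law:
  "0 \<le> q \<Longrightarrow> q \<le> 1 \<Longrightarrow> thin_law q \<in> config_space \<rightarrow>\<^sub>M subprob_algebra config_space"
  using measurable_superpose_thin_law[of "return_pmf {#}" q]
  by (simp add: thin_law_eq[abs_def] superpose_pmf_return_empty)

text \<open>Counts add up under superposition, so the preimage of a generating set is an event about
  a sum of two measurable counts.\<close>

lemma measurable_config_union:
  "(\<lambda>(\<mu>, \<nu>). \<mu> + \<nu>) \<in> config_space \<Otimes>\<^sub>M config_space \<rightarrow>\<^sub>M (config_space :: 'a::metric_space multiset measure)"
  unfolding config_space_def
proof (rule measurable_measure_of, unfold config_space_def[symmetric])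
  fix y assume "y \<in> {(\<lambda>\<phi>. npts \<phi> A) -` B |(A::'a set) B. A \<in> sets borel \<and> compact (closure A)}"
  then obtain A B where y: "y = (\<lambda>\<phi>. npts \<phi> A) -` B" and [measurable]: "A \<in> sets borel" and [simp]: "compact (closure A)"
    by auto
  have "(\<lambda>z. npts (fst z) A + npts (snd z) A) \<in> config_space \<Otimes>\<^sub>M config_space \<rightarrow>\<^sub>M count_space UNIV"
    by measurable
  from measurable_sets[OF this, of B]
  show "(\<lambda>(\<mu>, \<nu>). \<mu> + \<nu>) -` y \<inter> space (config_space \<Otimes>\<^sub>M config_space) \<in> sets (config_space \<Otimes>\<^sub>M config_space)"
    by (simp add: y vimage_def split_beta)
qed auto

lemma prob_space_glauber_law:
  assumes "prob_space Q" "sets Q = sets config_space" "0 \<le> t"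
  shows "prob_space (glauber_law Q t \<phi>)"
proof -
  have t: "0 \<le> 1 - exp (- t)" "1 - exp (- t) \<le> 1"
    using assms by auto
  note [measurable_cong] = assms(2)
  have tl: "thin_law (1 - exp (- t)) \<in> Q \<rightarrow>\<^sub>M subprob_algebra config_space"
    unfolding measurable_cong_sets[OF assms(2) refl] by (rule measurable_thin_law[OF t])
  interpret Q: prob_space Q by fact
  interpret A: prob_space "thin_law (exp (-t)) \<phi>"
    by (simp add: thin_law_eq prob_space_config_law)
  interpret B: prob_space "Q \<bind> thin_law (1 - exp (- t))"
    by (rule Q.prob_space_bind[OF _ tl]) (auto simp: thin_law_eq prob_space_config_law)
  interpret pair_prob_space "thin_law (exp (-t)) \<phi>" "Q \<bind> thin_law (1 - exp (- t))" ..
  have "sets (Q \<bind> thin_law (1 - exp (- t))) = sets config_space"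
    by (rule sets_bind) (auto simp: thin_law_eq Q.not_empty)
  then have "(\<lambda>(\<mu>, \<nu>). \<mu> + \<nu>) \<in> thin_law (exp (-t)) \<phi> \<Otimes>\<^sub>M (Q \<bind> thin_law (1 - exp (- t))) \<rightarrow>\<^sub>M config_space"
    using measurable_config_union
    by (simp add: thin_law_eq cong: measurable_cong_sets sets_pair_measure_cong)
  then show ?thesis
    unfolding glauber_law_def by (rule prob_space_distr)
qed

section \<open>The Poisson process\<close>

text \<open>The variable is expanded over the events \<open>N = k\<close> and the series is
  integrated term by term, which absolute summability permits. The explicit weights include the rate
  0.\<close>

lemma (in prob_space) expectation_poisson_count:
  fixes g :: "nat \<Rightarrow> real"
  assumes [measurable]: "N \<in> M \<rightarrow>\<^sub>M count_space UNIV"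
    and prob: "\<And>k. prob {\<omega>\<in>space M. N \<omega> = k} = m ^ k / fact k * exp (- m)"
    and g: "summable (\<lambda>k. \<bar>g k\<bar> * (m ^ k / fact k * exp (- m)))"
  shows "integrable M (\<lambda>\<omega>. g (N \<omega>))"
    and "(\<integral>\<omega>. g (N \<omega>) \<partial>M) = (\<Sum>k. g k * (m ^ k / fact k * exp (- m)))"
proof -
  define f where "f k \<omega> = g k * indicator {\<omega>\<in>space M. N \<omega> = k} \<omega>" for k \<omega>
  have f: "(\<lambda>k. f k \<omega>) sums g (N \<omega>)" if "\<omega> \<in> space M" for \<omega>
  proof -
    have "(\<lambda>k. f k \<omega>) = (\<lambda>k. if k = N \<omega> then g k else 0)"
      using that by (auto simp: f_def)
    then show ?thesis using sums_single[of "N \<omega>" g] by (simp only:)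
  qed
  have int: "integrable M (f k)" for k
    unfolding f_def by (intro integrable_mult_right) (auto simp: integrable_indicator_iff emeasure_eq_measure)
  have norm: "AE \<omega> in M. summable (\<lambda>k. norm (f k \<omega>))"
  proof (rule AE_I2)
    fix \<omega>
    show "summable (\<lambda>k. norm (f k \<omega>))"
      by (rule summable_finite[of "{N \<omega>}"]) (auto simp: f_def)
  qed
  have "(\<integral>\<omega>. norm (f k \<omega>) \<partial>M) = \<bar>g k\<bar> * (m ^ k / fact k * exp (- m))" for k
    unfolding f_def prob[symmetric] by (simp add: abs_mult)
  then have sum: "summable (\<lambda>k. \<integral>\<omega>. norm (f k \<omega>) \<partial>M)"
    using g by simp
  have eq: "(\<Sum>k. f k \<omega>) = g (N \<omega>)" if "\<omega> \<in> space M" for \<omega>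
    using f[OF that] by (simp add: sums_iff)
  have "integrable M (\<lambda>\<omega>. \<Sum>k. f k \<omega>)"
    by (rule integrable_suminf[OF int norm sum])
  then show "integrable M (\<lambda>\<omega>. g (N \<omega>))"
    using eq by (simp cong: Bochner_Integration.integrable_cong)
  have "(\<integral>\<omega>. (\<Sum>k. f k \<omega>) \<partial>M) = (\<Sum>k. \<integral>\<omega>. f k \<omega> \<partial>M)"
    by (rule integral_suminf[OF int norm sum])
  also have "(\<lambda>k. \<integral>\<omega>. f k \<omega> \<partial>M) = (\<lambda>k. g k * (m ^ k / fact k * exp (- m)))"
    unfolding f_def prob[symmetric] by simp
  finally show "(\<integral>\<omega>. g (N \<omega>) \<partial>M) = (\<Sum>k. g k * (m ^ k / fact k * exp (- m)))"
    using eq by (simp cong: Bochner_Integration.integral_cong)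
qed

lemma exp_sums_real: "(\<lambda>k. x ^ k / fact k) sums exp (x::real)"
  using exp_converges[of x] by (simp add: field_simps)

lemma poisson_pgf_sums:
  fixes m y :: real
  shows "(\<lambda>k. y ^ k * (m ^ k / fact k * exp (- m))) sums exp (- (m * (1 - y)))"
  using sums_mult2[OF exp_sums_real[of "y * m"], of "exp (- m)"]
  by (simp add: power_mult_distrib algebra_simps flip: exp_add)

lemma poisson_mean_summable:
  fixes m :: real
  shows "summable (\<lambda>k. real k * (m ^ k / fact k * exp (- m)))"
proof -
  \<comment> \<open>After a shift of the index, \<open>Suc k\<close> cancels against
    \<open>fact (Suc k)\<close> and leaves a multiple of the exponential series.\<close>
  have "(\<lambda>k. real (Suc k) * (m ^ Suc k / fact (Suc k) * exp (- m)))
      = (\<lambda>k. m ^ k / fact k * (m * exp (- m)))"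
    by (auto simp: fun_eq_iff divide_simps)
  then have "summable (\<lambda>k. real (Suc k) * (m ^ Suc k / fact (Suc k) * exp (- m)))"
    using sums_mult2[OF exp_sums_real[of m], of "m * exp (- m)"] by (simp add: sums_iff del: of_nat_Suc fact_Suc power_Suc)
  then show ?thesis
    by (subst (asm) summable_Suc_iff)
qed

lemma poisson_processD:
  assumes "poisson_process \<Omega> \<zeta> M"
  shows "prob_space \<Omega>" "\<zeta> \<in> \<Omega> \<rightarrow>\<^sub>M config_space"
    "\<And>A. A \<in> sets borel \<Longrightarrow> (\<lambda>\<omega>. npts (\<zeta> \<omega>) A) \<in> \<Omega> \<rightarrow>\<^sub>M count_space UNIV"
    "\<And>A k. A \<in> sets borel \<Longrightarrow>
        measure \<Omega> {\<omega>\<in>space \<Omega>. npts (\<zeta> \<omega>) A = k} = measure M A ^ k / fact k * exp (- measure M A)"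
    "\<And>n A. (\<And>i. i < n \<Longrightarrow> A i \<in> sets borel) \<Longrightarrow> disjoint_family_on A {..<n} \<Longrightarrow>
        prob_space.indep_vars \<Omega> (\<lambda>_. count_space UNIV) (\<lambda>i \<omega>. npts (\<zeta> \<omega>) (A i)) {..<n :: nat}"
  using assms unfolding poisson_process_def by simp_all

text \<open>The total count is Poisson and thus has a mean. This moment is the source of every
  dominating function used later for the unbounded \<open>F\<close>.\<close>

lemma poisson_process_integrable_size:
  assumes "poisson_process \<Omega> \<zeta> M"
  shows "integrable \<Omega> (\<lambda>\<omega>. real (size (\<zeta> \<omega>)))"
proof -
  interpret prob_space \<Omega> by (rule poisson_processD(1)[OF assms])
  have "integrable \<Omega> (\<lambda>\<omega>. real (npts (\<zeta> \<omega>) UNIV))"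
  proof (rule expectation_poisson_count)
    show "(\<lambda>\<omega>. npts (\<zeta> \<omega>) UNIV) \<in> \<Omega> \<rightarrow>\<^sub>M count_space UNIV"
      by (rule poisson_processD(3)[OF assms]) simp
    show "prob {\<omega> \<in> space \<Omega>. npts (\<zeta> \<omega>) UNIV = k} = measure M UNIV ^ k / fact k * exp (- measure M UNIV)" for k
      by (rule poisson_processD(4)[OF assms]) simp
  qed (use poisson_mean_summable in simp)
  then show ?thesis by simp
qed

text \<open>The level sets of \<open>u\<close> partition the space into finitely many Borel sets
  with independent Poisson counts. Each contributes \<open>exp (- (m i * (1 - e i)))\<close>, and
  the exponents add up to the integral of the simple function \<open>1 - u\<close>.\<close>

lemma poisson_process_gen_fun:
  fixes M :: "'a::metric_space measure"
  assumes P: "poisson_process \<Omega> \<zeta> M" and "finite_measure M" and sM: "sets M = sets borel"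
    and u: "u \<in> test_funs"
  shows "(\<integral>\<omega>. gen_fun u (\<zeta> \<omega>) \<partial>\<Omega>) = exp (- (\<integral>x. 1 - u x \<partial>M))"
proof -
  interpret prob_space \<Omega> by (rule poisson_processD(1)[OF P])
  interpret M: finite_measure M by fact
  note [measurable_cong] = sM
  have [simp]: "space M = UNIV" using sets_eq_imp_space_eq[OF sM] by simp
  have fin: "finite (range u)" and [measurable]: "u \<in> borel_measurable borel"
    using u by (auto simp: test_funs_def)
  define n where "n = card (range u)"
  \<comment> \<open>The values of \<open>u\<close> are enumerated because independence in
    \<open>poisson_process\<close> is stated for families indexed by \<open>{..<n}\<close>.\<close>
  obtain e where e: "bij_betw e {..<n} (range u)"
    using ex_bij_betw_nat_finite[OF fin] by (auto simp: n_def atLeast0LessThan)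
  define A where "A i = u -` {e i}" for i
  have A [measurable]: "A i \<in> sets borel" for i
    using measurable_sets[of u borel borel "{e i}"] by (simp add: A_def)
  have disj: "disjoint_family_on A {..<n}"
    using e by (auto simp: disjoint_family_on_def A_def bij_betw_def inj_on_def)
  have e01: "0 \<le> e i" "e i \<le> 1" if "i < n" for i
  proof -
    have "e i \<in> range u"
      using bij_betwE[OF e] that by blast
    then obtain x where "e i = u x" by blast
    then show "0 \<le> e i" "e i \<le> 1"
      using u by (auto simp: test_funs_def)
  qed
  define m where "m i = measure M (A i)" for i
  have rv [measurable]: "(\<lambda>\<omega>. npts (\<zeta> \<omega>) (A i)) \<in> \<Omega> \<rightarrow>\<^sub>M count_space UNIV" for i
    by (rule poisson_processD(3)[OF P A])
  have pr: "prob {\<omega>\<in>space \<Omega>. npts (\<zeta> \<omega>) (A i) = k} = m i ^ k / fact k * exp (- m i)" for i k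
    unfolding m_def by (rule poisson_processD(4)[OF P A])
  have "indep_vars (\<lambda>_. count_space UNIV) (\<lambda>i \<omega>. npts (\<zeta> \<omega>) (A i)) {..<n}"
    by (rule poisson_processD(5)[OF P A disj])
  then have indep: "indep_vars (\<lambda>_. borel) (\<lambda>i \<omega>. e i ^ npts (\<zeta> \<omega>) (A i)) {..<n}"
    by (rule indep_vars_compose2) simp
  have one: "integrable \<Omega> (\<lambda>\<omega>. e i ^ npts (\<zeta> \<omega>) (A i))"
      "(\<integral>\<omega>. e i ^ npts (\<zeta> \<omega>) (A i) \<partial>\<Omega>) = exp (- (m i * (1 - e i)))" if "i < n" for i
  proof -
    have "0 \<le> m i" by (simp add: m_def)
    then have s: "summable (\<lambda>k. \<bar>e i ^ k\<bar> * (m i ^ k / fact k * exp (- m i)))"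
      using poisson_pgf_sums[of "e i" "m i"] e01[OF that] by (simp add: sums_iff)
    show "integrable \<Omega> (\<lambda>\<omega>. e i ^ npts (\<zeta> \<omega>) (A i))"
      by (rule expectation_poisson_count[OF rv pr s])
    show "(\<integral>\<omega>. e i ^ npts (\<zeta> \<omega>) (A i) \<partial>\<Omega>) = exp (- (m i * (1 - e i)))"
      using expectation_poisson_count(2)[OF rv pr s] poisson_pgf_sums[of "e i" "m i"]
      by (simp add: sums_iff)
  qed
  have "gen_fun u \<psi> = (\<Prod>i<n. e i ^ npts \<psi> (A i))" for \<psi>
    unfolding gen_fun_conv_prod[OF fin] A_def by (rule prod.reindex_bij_betw[OF e, symmetric])
  then have "(\<integral>\<omega>. gen_fun u (\<zeta> \<omega>) \<partial>\<Omega>) = (\<Prod>i<n. \<integral>\<omega>. e i ^ npts (\<zeta> \<omega>) (A i) \<partial>\<Omega>)"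
    using indep_vars_lebesgue_integral[OF _ indep] one by simp
  also have "\<dots> = exp (\<Sum>i<n. - (m i * (1 - e i)))"
    by (simp add: exp_sum one)
  also have "(\<Sum>i<n. - (m i * (1 - e i))) = - (\<Sum>i<n. m i * (1 - e i))"
    by (rule sum_negf)
  also have "(\<Sum>i<n. m i * (1 - e i)) = (\<integral>x. (\<Sum>i<n. (1 - e i) * indicator (A i) x) \<partial>M)"
    by (subst Bochner_Integration.integral_sum)
      (auto simp: m_def sM mult.commute integrable_indicator_iff M.emeasure_eq_measure intro!: integrable_mult_left)
  also have "\<dots> = (\<integral>x. 1 - u x \<partial>M)"
  proof (rule Bochner_Integration.integral_cong)
    fix x
    have "(\<Sum>i<n. (1 - e i) * indicator (A i) x) = (\<Sum>i<n. (\<lambda>y. if y = u x then 1 - y else 0) (e i))"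
      by (intro sum.cong) (auto simp: A_def indicator_def)
    also have "\<dots> = (\<Sum>y\<in>range u. if y = u x then 1 - y else 0)"
      by (rule sum.reindex_bij_betw[OF e])
    also have "\<dots> = 1 - u x"
      using fin by (simp add: sum.delta)
    finally show "(\<Sum>i<n. (1 - e i) * indicator (A i) x) = 1 - u x" .
  qed simp
  finally show ?thesis .
qed

section \<open>The semigroup property\<close>

text \<open>Integration against a mixture for signed, possibly unbounded integrands, as Lipschitz
  functions are. Positive and negative parts are treated by the nonnegative version; finiteness of
  the absolute iterated integral makes their difference meaningful.\<close>

lemma integral_bind_integrable:
  fixes f :: "'b \<Rightarrow> real"
  assumes [measurable]: "K \<in> M \<rightarrow>\<^sub>M subprob_algebra N" "f \<in> borel_measurable N"
    and fin: "(\<integral>\<^sup>+x. \<integral>\<^sup>+y. ennreal \<bar>f y\<bar> \<partial>K x \<partial>M) < \<infinity>"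
    and ne: "space M \<noteq> {}"
  shows "integrable (M \<bind> K) f" "(\<integral>y. f y \<partial>(M \<bind> K)) = (\<integral>x. \<integral>y. f y \<partial>K x \<partial>M)"
    "integrable M (\<lambda>x. \<integral>y. f y \<partial>K x)"
proof -
  have sK: "sets (K x) = sets N" if "x \<in> space M" for x
    using assms(1) that by (rule sets_kernel)
  have sets [measurable_cong]: "sets (M \<bind> K) = sets N"
    by (rule sets_bind[OF sK ne])
  have abs: "(\<integral>\<^sup>+y. ennreal \<bar>f y\<bar> \<partial>(M \<bind> K)) = (\<integral>\<^sup>+x. \<integral>\<^sup>+y. ennreal \<bar>f y\<bar> \<partial>K x \<partial>M)"
    by (rule nn_integral_bind) measurable
  then show int: "integrable (M \<bind> K) f"
    using fin by (intro integrableI_bounded) auto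
  have "AE x in M. (\<integral>\<^sup>+y. ennreal \<bar>f y\<bar> \<partial>K x) \<noteq> \<infinity>"
    using fin by (intro nn_integral_PInf_AE) (auto intro!: measurable_compose[OF assms(1) nn_integral_measurable_subprob_algebra])
  then have AE: "AE x in M. integrable (K x) f"
  proof (rule AE_mp, intro AE_I2 impI)
    fix x assume "x \<in> space M" "(\<integral>\<^sup>+y. ennreal \<bar>f y\<bar> \<partial>K x) \<noteq> \<infinity>"
    then show "integrable (K x) f"
      using sK by (intro integrableI_bounded) (auto simp: less_top cong: measurable_cong_sets)
  qed
  have meas [measurable]: "(\<lambda>x. \<integral>y. f y \<partial>K x) \<in> borel_measurable M"
    by (rule measurable_compose[OF assms(1) integral_measurable_subprob_algebra]) measurable
  \<comment> \<open>For an \<open>x\<close> at which \<open>f\<close> is not integrable, the inner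
    integral has the default value 0 and the bound still holds.\<close>
  have bd: "ennreal \<bar>\<integral>y. f y \<partial>K x\<bar> \<le> (\<integral>\<^sup>+y. ennreal \<bar>f y\<bar> \<partial>K x)" for x
    using integral_norm_bound_ennreal[of "K x" f] by (cases "integrable (K x) f") (auto simp: not_integrable_integral_eq)
  show intK: "integrable M (\<lambda>x. \<integral>y. f y \<partial>K x)"
    by (rule integrableI_bounded[OF meas]) (use le_less_trans[OF nn_integral_mono[OF bd] fin] in simp)
  define p where "p y = max 0 (f y)" for y
  define q where "q y = max 0 (- f y)" for y
  have [measurable]: "p \<in> borel_measurable N" "q \<in> borel_measurable N"
    unfolding p_def q_def by measurable
  have nn: "(\<integral>y. g y \<partial>(M \<bind> K)) = (\<integral>x. \<integral>y. g y \<partial>K x \<partial>M)" "integrable M (\<lambda>x. \<integral>y. g y \<partial>K x)"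
      "AE x in M. integrable (K x) g"  "integrable (M \<bind> K) g"
    if g [measurable]: "g \<in> borel_measurable N" and g0: "\<And>y. 0 \<le> g y" and gf: "\<And>y. g y \<le> \<bar>f y\<bar>" for g
  proof -
    show ig: "integrable (M \<bind> K) g"
      by (rule Bochner_Integration.integrable_bound[OF int]) (use g0 gf in auto)
    show AEg: "AE x in M. integrable (K x) g"
      using AE
    proof (rule AE_mp, intro AE_I2 impI)
      fix x assume "x \<in> space M" "integrable (K x) f"
      then show "integrable (K x) g"
        using g sK[OF \<open>x \<in> space M\<close>] g0 gf
        by (intro Bochner_Integration.integrable_bound[OF \<open>integrable (K x) f\<close>]) (auto cong: measurable_cong_sets)
    qed
    have [measurable]: "(\<lambda>x. \<integral>y. g y \<partial>K x) \<in> borel_measurable M"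
      by (rule measurable_compose[OF assms(1) integral_measurable_subprob_algebra]) measurable
    have "(\<integral>\<^sup>+y. ennreal (g y) \<partial>(M \<bind> K)) = (\<integral>\<^sup>+x. \<integral>\<^sup>+y. ennreal (g y) \<partial>K x \<partial>M)"
      by (rule nn_integral_bind) measurable
    also have "\<dots> = (\<integral>\<^sup>+x. ennreal (\<integral>y. g y \<partial>K x) \<partial>M)"
      using AEg by (intro nn_integral_cong_AE, eventually_elim) (simp add: nn_integral_eq_integral g0)
    finally have eq: "ennreal (\<integral>y. g y \<partial>(M \<bind> K)) = (\<integral>\<^sup>+x. ennreal (\<integral>y. g y \<partial>K x) \<partial>M)"
      using ig g0 by (simp add: nn_integral_eq_integral)
    show "integrable M (\<lambda>x. \<integral>y. g y \<partial>K x)"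
      by (rule integrableI_nn_integral_finite[OF _ _ eq[symmetric]]) (auto simp: g0)
    then have "ennreal (\<integral>y. g y \<partial>(M \<bind> K)) = ennreal (\<integral>x. \<integral>y. g y \<partial>K x \<partial>M)"
      unfolding eq by (intro nn_integral_eq_integral) (auto simp: g0)
    then show "(\<integral>y. g y \<partial>(M \<bind> K)) = (\<integral>x. \<integral>y. g y \<partial>K x \<partial>M)"
      by (simp add: g0)
  qed
  have p: "p \<in> borel_measurable N" "\<And>y. 0 \<le> p y" "\<And>y. p y \<le> \<bar>f y\<bar>"
    and q: "q \<in> borel_measurable N" "\<And>y. 0 \<le> q y" "\<And>y. q y \<le> \<bar>f y\<bar>"
    by (auto simp: p_def q_def)
  have f: "f = (\<lambda>y. p y - q y)"
    by (auto simp: p_def q_def fun_eq_iff)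
  have "(\<integral>y. f y \<partial>(M \<bind> K)) = (\<integral>y. p y \<partial>(M \<bind> K)) - (\<integral>y. q y \<partial>(M \<bind> K))"
    unfolding f by (rule Bochner_Integration.integral_diff[OF nn(4)[OF p] nn(4)[OF q]])
  also have "\<dots> = (\<integral>x. (\<integral>y. p y \<partial>K x) - (\<integral>y. q y \<partial>K x) \<partial>M)"
    unfolding nn(1)[OF p] nn(1)[OF q]
    by (rule Bochner_Integration.integral_diff[OF nn(2)[OF p] nn(2)[OF q], symmetric])
  also have "\<dots> = (\<integral>x. \<integral>y. f y \<partial>K x \<partial>M)"
  proof (rule integral_cong_AE)
    show "AE x in M. (\<integral>y. p y \<partial>K x) - (\<integral>y. q y \<partial>K x) = (\<integral>y. f y \<partial>K x)"
      using nn(3)[OF p] nn(3)[OF q] by eventually_elim (simp add: f)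
  qed (use nn(2)[OF p] nn(2)[OF q] meas in auto)
  finally show "(\<integral>y. f y \<partial>(M \<bind> K)) = (\<integral>x. \<integral>y. f y \<partial>K x \<partial>M)" .
qed

locale config_prob_space = prob_space Q
  for Q :: "'a::metric_space multiset measure" +
  assumes sets_Q [measurable_cong]: "sets Q = sets config_space"
begin

lemma space_Q [simp]: "space Q = UNIV"
  using sets_eq_imp_space_eq[OF sets_Q] by simp

lemma measurable_thin_law_Q:
  "0 \<le> q \<Longrightarrow> q \<le> 1 \<Longrightarrow> thin_law q \<in> Q \<rightarrow>\<^sub>M subprob_algebra config_space"
  unfolding measurable_cong_sets[OF sets_Q refl] by (rule measurable_thin_law)

lemma sets_glauber_law [measurable_cong, simp]: "sets (glauber_law Q t \<phi>) = sets config_space"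
  by (simp add: glauber_law_def)

lemma space_glauber_law [simp]: "space (glauber_law Q t \<phi>) = UNIV"
  by (simp add: glauber_law_def)

lemma prob_space_glauber: "0 \<le> t \<Longrightarrow> prob_space (glauber_law Q t \<phi>)"
  by (rule prob_space_glauber_law[OF prob_space_axioms sets_Q])

lemma integral_gen_fun_bind:
  assumes K: "K \<in> N \<rightarrow>\<^sub>M subprob_algebra config_space" and "prob_space N" and u: "u \<in> test_funs"
  shows "(\<integral>\<psi>. gen_fun u \<psi> \<partial>(N \<bind> K)) = (\<integral>\<xi>. \<integral>\<psi>. gen_fun u \<psi> \<partial>K \<xi> \<partial>N)"
proof (rule integral_bind[where B = 1 and B' = 1, OF borel_measurable_gen_fun[OF u] _ K])
  show "finite_measure N"
    using assms(2) by (rule prob_space.finite_measure)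
  show "AE x in N. emeasure (K x) (space (K x)) \<le> ennreal 1"
    using subprob_space.emeasure_space_le_1[OF subprob_space_kernel[OF K]] by (intro AE_I2) simp
qed (use gen_fun_bounds[OF u] in auto)

text \<open>The two thinnings are independent, so by Fubini the functional of their superposition
  factorises; the second factor is evaluated conditionally on the configuration drawn from
  \<open>Q\<close>.\<close>

lemma integral_gen_fun_glauber_law:
  assumes "0 \<le> t" and u: "u \<in> test_funs"
  shows "(\<integral>\<psi>. gen_fun u \<psi> \<partial>glauber_law Q t \<phi>) =
    gen_fun (thin_fun (exp (- t)) u) \<phi> * (\<integral>\<psi>. gen_fun (thin_fun (1 - exp (- t)) u) \<psi> \<partial>Q)"
proof -
  have t: "0 \<le> 1 - exp (- t)" "1 - exp (- t) \<le> 1" "0 \<le> exp (- t)" "exp (- t) \<le> 1"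
    using assms by auto
  define A where "A = thin_law (exp (- t)) \<phi>"
  define B where "B = Q \<bind> thin_law (1 - exp (- t))"
  note tl = measurable_thin_law_Q[OF t(1,2)]
  interpret A: prob_space A
    by (simp add: A_def thin_law_eq prob_space_config_law)
  interpret B: prob_space B
    unfolding B_def by (rule prob_space_bind[OF _ tl]) (auto simp: thin_law_eq prob_space_config_law)
  interpret AB: pair_prob_space A B ..
  have sets [measurable_cong]: "sets A = sets config_space" "sets B = sets config_space"
    unfolding B_def by (simp add: A_def thin_law_eq) (rule sets_bind, auto simp: thin_law_eq)
  note [measurable] = borel_measurable_gen_fun[OF u]
  have plus: "(\<lambda>(\<mu>, \<nu>). \<mu> + \<nu>) \<in> A \<Otimes>\<^sub>M B \<rightarrow>\<^sub>M config_space"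
    unfolding measurable_cong_sets[OF sets_pair_measure_cong[OF sets] refl] by (rule measurable_config_union)
  have "(\<integral>\<psi>. gen_fun u \<psi> \<partial>glauber_law Q t \<phi>) = (\<integral>z. gen_fun u (case z of (\<mu>, \<nu>) \<Rightarrow> \<mu> + \<nu>) \<partial>(A \<Otimes>\<^sub>M B))"
    unfolding glauber_law_def A_def[symmetric] B_def[symmetric]
    by (rule integral_distr[OF plus borel_measurable_gen_fun[OF u]])
  also have "\<dots> = (\<integral>z. (case z of (\<mu>, \<nu>) \<Rightarrow> gen_fun u \<mu> * gen_fun u \<nu>) \<partial>(A \<Otimes>\<^sub>M B))"
    by (intro Bochner_Integration.integral_cong) auto
  also have "\<dots> = (\<integral>\<mu>. \<integral>\<nu>. gen_fun u \<mu> * gen_fun u \<nu> \<partial>B \<partial>A)"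
    by (rule AB.integral_fst[symmetric], rule AB.P.integrable_const_bound[of _ 1])
      (auto simp: split_beta abs_mult gen_fun_bounds[OF u] intro!: mult_le_one)
  also have "\<dots> = (\<integral>\<mu>. gen_fun u \<mu> \<partial>A) * (\<integral>\<nu>. gen_fun u \<nu> \<partial>B)"
    by simp
  also have "(\<integral>\<mu>. gen_fun u \<mu> \<partial>A) = gen_fun (thin_fun (exp (- t)) u) \<phi>"
    using t by (simp add: A_def thin_law_eq integral_config_law borel_measurable_gen_fun[OF u] expectation_gen_fun_thin)
  also have "(\<integral>\<nu>. gen_fun u \<nu> \<partial>B) = (\<integral>\<psi>. gen_fun (thin_fun (1 - exp (- t)) u) \<psi> \<partial>Q)"
    unfolding B_def integral_gen_fun_bind[OF tl prob_space_axioms u]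
    using t by (simp add: thin_law_eq integral_config_law borel_measurable_gen_fun[OF u] expectation_gen_fun_thin)
  finally show ?thesis .
qed

lemma measurable_glauber_law:
  assumes "0 \<le> t"
  shows "glauber_law Q t \<in> config_space \<rightarrow>\<^sub>M subprob_algebra config_space"
proof (rule config_kernel_measurable)
  fix u :: "'a \<Rightarrow> real" assume u: "u \<in> test_funs"
  have "gen_fun (thin_fun (exp (- t)) u) \<in> borel_measurable config_space"
    using assms by (intro borel_measurable_gen_fun test_funs_thin_fun u) auto
  then show "(\<lambda>\<phi>. \<integral>\<psi>. gen_fun u \<psi> \<partial>glauber_law Q t \<phi>) \<in> borel_measurable config_space"
    unfolding integral_gen_fun_glauber_law[OF assms u] by measurable
qed (simp_all add: prob_space_glauber assms)

end

text \<open>The conditional law of the Glauber process at time \<open>t\<close>, started at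
  \<open>\<phi>\<close>, given that the random configuration is \<open>\<xi>\<close>. It has finite
  support, so every function has an expectation under it.\<close>

definition thin_flow :: "'a multiset \<Rightarrow> 'a multiset \<Rightarrow> real \<Rightarrow> 'a multiset pmf" where
  "thin_flow \<phi> \<xi> t = superpose_pmf (thin_pmf (exp (- t)) \<phi>) (thin_pmf (1 - exp (- t)) \<xi>)"

lemma finite_set_pmf_thin_flow: "finite (set_pmf (thin_flow \<phi> \<xi> t))"
  unfolding thin_flow_def by (intro finite_set_pmf_superpose_thin finite_set_pmf_thin)

lemma size_thin_flow: "\<psi> \<in> set_pmf (thin_flow \<phi> \<xi> t) \<Longrightarrow> size \<psi> \<le> size \<phi> + size \<xi>"
  unfolding thin_flow_def by (rule size_superpose_thin) (use size_thin in auto)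

context config_prob_space
begin

lemma measurable_thin_flow:
  assumes "0 \<le> t"
  shows "(\<lambda>\<xi>. config_law (thin_flow \<phi> \<xi> t)) \<in> Q \<rightarrow>\<^sub>M subprob_algebra config_space"
  unfolding measurable_cong_sets[OF sets_Q refl] thin_flow_def
  by (rule measurable_superpose_thin_law) (use assms in \<open>auto intro: finite_set_pmf_thin\<close>)

text \<open>Disintegration over the random configuration: drawing \<open>\<xi>\<close> first or
  superposing first gives the same law, as the generating functionals coincide.\<close>

lemma glauber_law_conv_bind:
  assumes "0 \<le> t"
  shows "glauber_law Q t \<phi> = Q \<bind> (\<lambda>\<xi>. config_law (thin_flow \<phi> \<xi> t))"
proof (rule config_measure_eqI)
  show "finite_measure (glauber_law Q t \<phi>)"
    using prob_space_glauber[OF assms] by (rule prob_space.finite_measure)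
  have "prob_space (Q \<bind> (\<lambda>\<xi>. config_law (thin_flow \<phi> \<xi> t)))"
    by (rule prob_space_bind[OF _ measurable_thin_flow[OF assms]]) (simp add: prob_space_config_law)
  then show "finite_measure (Q \<bind> (\<lambda>\<xi>. config_law (thin_flow \<phi> \<xi> t)))"
    by (rule prob_space.finite_measure)
  show "sets (Q \<bind> (\<lambda>\<xi>. config_law (thin_flow \<phi> \<xi> t))) = sets config_space"
    by (rule sets_bind) auto
  fix u :: "'a \<Rightarrow> real" assume u: "u \<in> test_funs"
  show "(\<integral>\<psi>. gen_fun u \<psi> \<partial>glauber_law Q t \<phi>) = (\<integral>\<psi>. gen_fun u \<psi> \<partial>(Q \<bind> (\<lambda>\<xi>. config_law (thin_flow \<phi> \<xi> t))))"
    unfolding integral_gen_fun_bind[OF measurable_thin_flow[OF assms] prob_space_axioms u]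
      integral_gen_fun_glauber_law[OF assms u] integral_config_law[OF borel_measurable_gen_fun[OF u]]
    unfolding thin_flow_def using assms by (simp add: expectation_gen_fun_superpose_thin finite_set_pmf_thin expectation_gen_fun_thin)
qed simp

text \<open>With \<open>p = exp (- t)\<close> and \<open>q = exp (- s)\<close>, the initial points
  survive with probability \<open>p * q\<close>, and the immigrant parts have exponents that add:
  \<open>(1 - p) * q + (1 - q) = 1 - p * q\<close>. The exponential form of the functional of
  \<open>Q\<close> is what turns products into this sum.\<close>

lemma glauber_law_semigroup:
  assumes "0 \<le> s" "0 \<le> t"
    and Q: "\<And>u. u \<in> test_funs \<Longrightarrow> (\<integral>\<psi>. gen_fun u \<psi> \<partial>Q) = exp (- (\<integral>x. 1 - u x \<partial>M))"
  shows "glauber_law Q t \<phi> \<bind> glauber_law Q s = glauber_law Q (t + s) \<phi>"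
proof (rule config_measure_eqI)
  interpret G: prob_space "glauber_law Q t \<phi>"
    by (rule prob_space_glauber) fact
  have K: "glauber_law Q s \<in> glauber_law Q t \<phi> \<rightarrow>\<^sub>M subprob_algebra config_space"
    unfolding measurable_cong_sets[OF sets_glauber_law refl] by (rule measurable_glauber_law) fact
  have "prob_space (glauber_law Q t \<phi> \<bind> glauber_law Q s)"
    by (rule G.prob_space_bind[OF _ K]) (simp add: prob_space_glauber assms)
  then show "finite_measure (glauber_law Q t \<phi> \<bind> glauber_law Q s)"
    by (rule prob_space.finite_measure)
  have "prob_space (glauber_law Q (t + s) \<phi>)"
    by (rule prob_space_glauber) (use assms in simp)
  then show "finite_measure (glauber_law Q (t + s) \<phi>)"
    by (rule prob_space.finite_measure)
  show "sets (glauber_law Q t \<phi> \<bind> glauber_law Q s) = sets config_space"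
    by (rule sets_bind) auto
  fix u :: "'a \<Rightarrow> real" assume u: "u \<in> test_funs"
  \<comment> \<open>Thinning scales the intensity by \<open>r\<close>, because
    \<open>1 - thin_fun r v x = r * (1 - v x)\<close>.\<close>
  have Qt: "(\<integral>\<psi>. gen_fun (thin_fun r v) \<psi> \<partial>Q) = exp (- (r * (\<integral>x. 1 - v x \<partial>M)))"
    if "v \<in> test_funs" "0 \<le> r" "r \<le> 1" for v r
  proof -
    have "(\<integral>x. 1 - thin_fun r v x \<partial>M) = (\<integral>x. r * (1 - v x) \<partial>M)"
      by (simp add: thin_fun_def algebra_simps)
    then show ?thesis
      using Q[OF test_funs_thin_fun[OF that]] by simp
  qed
  define I where "I = (\<integral>x. 1 - u x \<partial>M)"
  define p where "p = exp (- t)"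
  define q where "q = exp (- s)"
  have pq: "0 \<le> p" "p \<le> 1" "0 \<le> q" "q \<le> 1" "exp (- (t + s)) = p * q" "p * q \<le> 1"
    using assms by (auto simp: p_def q_def mult_le_one simp flip: exp_add)
  have uq: "thin_fun q u \<in> test_funs"
    using u pq by (intro test_funs_thin_fun)
  have "(\<integral>x. 1 - thin_fun q u x \<partial>M) = (\<integral>x. q * (1 - u x) \<partial>M)"
    by (simp add: thin_fun_def algebra_simps)
  then have Iq: "(\<integral>x. 1 - thin_fun q u x \<partial>M) = q * I"
    by (simp add: I_def)
  have "(\<integral>\<psi>. gen_fun u \<psi> \<partial>(glauber_law Q t \<phi> \<bind> glauber_law Q s))
      = (\<integral>\<psi>. gen_fun (thin_fun q u) \<psi> * exp (- ((1 - q) * I)) \<partial>glauber_law Q t \<phi>)"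
    unfolding integral_gen_fun_bind[OF K G.prob_space_axioms u] integral_gen_fun_glauber_law[OF assms(1) u]
    using pq Qt[OF u, of "1 - q"] by (simp add: I_def q_def)
  also have "\<dots> = gen_fun (thin_fun p (thin_fun q u)) \<phi> * exp (- ((1 - p) * (q * I))) * exp (- ((1 - q) * I))"
    using pq Qt[OF uq, of "1 - p"] integral_gen_fun_glauber_law[OF assms(2) uq, of \<phi>]
    by (simp add: Iq p_def[symmetric])
  also have "\<dots> = gen_fun (thin_fun (p * q) u) \<phi> * exp (- ((1 - p * q) * I))"
    by (simp add: thin_fun_thin_fun algebra_simps flip: exp_add)
  also have "\<dots> = (\<integral>\<psi>. gen_fun u \<psi> \<partial>glauber_law Q (t + s) \<phi>)"
    using integral_gen_fun_glauber_law[OF _ u, of "t + s" \<phi>] assms(1,2) pq Qt[OF u, of "1 - p * q"]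
    by (simp add: I_def)
  finally show "(\<integral>\<psi>. gen_fun u \<psi> \<partial>(glauber_law Q t \<phi> \<bind> glauber_law Q s)) = (\<integral>\<psi>. gen_fun u \<psi> \<partial>glauber_law Q (t + s) \<phi>)" .
qed simp

end

section \<open>Differentiation along the thinning flow\<close>

text \<open>The one-point form of the Lipschitz condition. It gives linear growth in the number of
  points and bounds the increments in the derivative formula.\<close>

definition add_lipschitz :: "('a multiset \<Rightarrow> real) \<Rightarrow> bool" where
  "add_lipschitz F \<longleftrightarrow> (\<forall>x \<psi>. \<bar>F (add_mset x \<psi>) - F \<psi>\<bar> \<le> 1)"

lemma TV_dist_add_mset_le: "TV_dist (add_mset x \<psi>) \<psi> \<le> 1"
  unfolding TV_dist_def by (rule cSUP_least) (auto intro: exI[of _ "{}"])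

lemma TV_lipschitz1_imp_add_lipschitz: "TV_lipschitz1 F \<Longrightarrow> add_lipschitz F"
  unfolding TV_lipschitz1_def add_lipschitz_def
  using TV_dist_add_mset_le order_trans by blast

lemma add_lipschitz_abs_le:
  assumes "add_lipschitz F"
  shows "\<bar>F \<psi>\<bar> \<le> \<bar>F {#}\<bar> + real (size \<psi>)"
proof (induction \<psi>)
  case (add x \<psi>)
  have "\<bar>F (add_mset x \<psi>) - F \<psi>\<bar> \<le> 1"
    using assms by (simp add: add_lipschitz_def)
  with add show ?case by simp
qed simp

lemma add_lipschitz_add_mset: "add_lipschitz F \<Longrightarrow> add_lipschitz (\<lambda>\<psi>. F (add_mset x \<psi>))"
  by (simp add: add_lipschitz_def add_mset_commute)

text \<open>All Lipschitz \<open>F\<close> are covered at once, with a common \<open>c\<close>,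
  because adding a point in the induction replaces \<open>F\<close> by
  \<open>\<lambda>\<psi>. F (add_mset x \<psi>)\<close>. At time 0 the derivative is
  one-sided.\<close>

definition decaying_derivative :: "(real \<Rightarrow> 'a multiset pmf) \<Rightarrow> real \<Rightarrow> bool" where
  "decaying_derivative D c \<longleftrightarrow> (\<forall>F. add_lipschitz F \<longrightarrow> (\<exists>d. \<forall>t\<ge>0.
     ((\<lambda>t. measure_pmf.expectation (D t) F) has_real_derivative d t) (at t within {0..})
     \<and> \<bar>d t\<bar> \<le> c * exp (- t)))"

text \<open>
  By the product rule the new point contributes \<open>p'\<close> times the mean of an increment
  \<open>F (add_mset x \<psi>) - F \<psi>\<close>, which is at most \<open>1\<close> in absolute value.
\<close>

lemma decaying_derivative_thin_step:
  assumes D: "decaying_derivative D c" and fin: "\<And>t. finite (set_pmf (D t))"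
    and p: "\<And>t. 0 \<le> t \<Longrightarrow> 0 \<le> p t \<and> p t \<le> 1"
    and p': "\<And>t. 0 \<le> t \<Longrightarrow> (p has_real_derivative p' t) (at t within {0..})"
    and p'_le: "\<And>t. 0 \<le> t \<Longrightarrow> \<bar>p' t\<bar> \<le> exp (- t)"
  shows "decaying_derivative (\<lambda>t. thin_step (p t) x (D t)) (c + 1)"
  unfolding decaying_derivative_def
proof (intro allI impI)
  fix F :: "'a multiset \<Rightarrow> real" assume F: "add_lipschitz F"
  define F' where "F' \<psi> = F (add_mset x \<psi>)" for \<psi>
  have F': "add_lipschitz F'"
    using add_lipschitz_add_mset[OF F] by (simp add: F'_def[abs_def])
  from D F obtain d where d: "\<And>t. t \<ge> 0 \<Longrightarrow>
      ((\<lambda>t. measure_pmf.expectation (D t) F) has_real_derivative d t) (at t within {0..})"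
      "\<And>t. t \<ge> 0 \<Longrightarrow> \<bar>d t\<bar> \<le> c * exp (- t)"
    unfolding decaying_derivative_def by blast
  from D F' obtain d' where d': "\<And>t. t \<ge> 0 \<Longrightarrow>
      ((\<lambda>t. measure_pmf.expectation (D t) F') has_real_derivative d' t) (at t within {0..})"
      "\<And>t. t \<ge> 0 \<Longrightarrow> \<bar>d' t\<bar> \<le> c * exp (- t)"
    unfolding decaying_derivative_def by blast
  let ?E = "\<lambda>t. measure_pmf.expectation (D t) F" and ?E' = "\<lambda>t. measure_pmf.expectation (D t) F'"
  define e where "e t = p' t * (?E' t - ?E t) + (p t * d' t + (1 - p t) * d t)" for t
  show "\<exists>d. \<forall>t\<ge>0. ((\<lambda>t. measure_pmf.expectation (thin_step (p t) x (D t)) F) has_real_derivative d t)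
      (at t within {0..}) \<and> \<bar>d t\<bar> \<le> (c + 1) * exp (- t)"
  proof (intro exI[of _ e] allI impI conjI)
    fix t :: real assume t: "t \<ge> 0"
    have "((\<lambda>t. p t * ?E' t + (1 - p t) * ?E t) has_real_derivative e t) (at t within {0..})"
      by (rule derivative_eq_intros p'[OF t] d(1)[OF t] d'(1)[OF t] refl)+
        (simp add: e_def algebra_simps)
    \<comment> \<open>The two-term expansion of \<open>thin_step\<close> requires \<open>p t\<close>
      to be a probability, hence the transfer of the derivative within \<open>{0..}\<close>
      only.\<close>
    then show "((\<lambda>t. measure_pmf.expectation (thin_step (p t) x (D t)) F) has_real_derivative e t) (at t within {0..})"
      unfolding has_field_derivative_def
      by (rule has_derivative_transform[rotated 2])
        (use t p fin in \<open>auto simp: expectation_thin_step F'_def[abs_def]\<close>)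
    have "?E' t - ?E t = measure_pmf.expectation (D t) (\<lambda>\<psi>. F' \<psi> - F \<psi>)"
      using fin by (simp add: integrable_measure_pmf_finite)
    also have "\<bar>\<dots>\<bar> \<le> measure_pmf.expectation (D t) (\<lambda>\<psi>. \<bar>F' \<psi> - F \<psi>\<bar>)"
      by (rule integral_abs_bound)
    also have "\<dots> \<le> measure_pmf.expectation (D t) (\<lambda>\<psi>. 1)"
      by (rule integral_mono) (use fin F in \<open>auto simp: integrable_measure_pmf_finite add_lipschitz_def F'_def\<close>)
    finally have "\<bar>?E' t - ?E t\<bar> \<le> 1" by simp
    then have 1: "\<bar>p' t * (?E' t - ?E t)\<bar> \<le> exp (- t) * 1"
      unfolding abs_mult by (intro mult_mono p'_le t) auto
    \<comment> \<open>A convex combination of derivatives bounded with constant \<open>c\<close>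
      keeps that constant; only the derivative of the new coin adds 1.\<close>
    have "\<bar>p t * d' t + (1 - p t) * d t\<bar> \<le> p t * \<bar>d' t\<bar> + (1 - p t) * \<bar>d t\<bar>"
      using p[OF t] by (intro order_trans[OF abs_triangle_ineq]) (simp add: abs_mult)
    also have "\<dots> \<le> p t * (c * exp (- t)) + (1 - p t) * (c * exp (- t))"
      using p[OF t] t by (intro add_mono mult_left_mono d d') auto
    finally have 2: "\<bar>p t * d' t + (1 - p t) * d t\<bar> \<le> c * exp (- t)"
      by (simp add: algebra_simps)
    have "\<bar>e t\<bar> \<le> exp (- t) * 1 + c * exp (- t)"
      unfolding e_def by (intro order_trans[OF abs_triangle_ineq] add_mono 1 2)
    then show "\<bar>e t\<bar> \<le> (c + 1) * exp (- t)"
      by (simp add: algebra_simps)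
  qed
qed

text \<open>The recursion removes the points of \<open>\<xi>\<close> first and those of
  \<open>\<phi>\<close> once \<open>\<xi>\<close> is empty; the nested inductions below follow this
  order.\<close>

lemma thin_flow_simps:
  "thin_flow {#} {#} t = return_pmf {#}"
  "thin_flow (add_mset x \<phi>) {#} t = thin_step (exp (- t)) x (thin_flow \<phi> {#} t)"
  "thin_flow \<phi> (add_mset x \<xi>) t = thin_step (1 - exp (- t)) x (thin_flow \<phi> \<xi> t)"
  by (simp_all add: thin_flow_def thin_pmf_add_mset flip: superpose_pmf_thin_add_mset)
    (simp add: thin_pmf_empty superpose_pmf_return_empty)

text \<open>Russo's formula one coin at a time: both retention probabilities have derivatives of
  modulus \<open>exp (- t)\<close>, so each point raises the constant by 1.\<close>

lemma decaying_derivative_thin_flow: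
  fixes \<phi> \<xi> :: "'a multiset"
  shows "decaying_derivative (thin_flow \<phi> \<xi>) (real (size \<phi>) + real (size \<xi>))"
proof (induction \<xi>)
  case empty
  show ?case
  proof (induction \<phi>)
    case empty
    show ?case
      by (auto simp: decaying_derivative_def thin_flow_simps intro!: exI[of _ "\<lambda>_. 0"])
  next
    case (add x \<phi>)
    have "decaying_derivative (\<lambda>t. thin_step (exp (- t)) x (thin_flow \<phi> {#} t)) (real (size \<phi>) + real (size ({#} :: 'a multiset)) + 1)"
      by (rule decaying_derivative_thin_step[where p' = "\<lambda>t. - exp (- t)", OF add finite_set_pmf_thin_flow])
        (auto intro!: derivative_eq_intros)
    then show ?case
      by (simp add: thin_flow_simps[abs_def] add.commute)
  qed
next
  case (add x \<xi>)
  have "decaying_derivative (\<lambda>t. thin_step (1 - exp (- t)) x (thin_flow \<phi> \<xi> t)) (real (size \<phi>) + real (size \<xi>) + 1)"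
    by (rule decaying_derivative_thin_step[where p' = "\<lambda>t. exp (- t)", OF add finite_set_pmf_thin_flow])
      (auto intro!: derivative_eq_intros)
  then show ?case
    by (simp add: thin_flow_simps[abs_def] add_ac)
qed

section \<open>The flow at time zero and at infinity\<close>

lemma expectation_thin_flow_0:
  fixes F :: "'a multiset \<Rightarrow> real"
  shows "measure_pmf.expectation (thin_flow \<phi> \<xi> 0) F = F \<phi>"
proof (induction \<xi>)
  case empty
  show ?case
    by (induction \<phi> arbitrary: F)
      (simp_all add: thin_flow_simps expectation_thin_step finite_set_pmf_thin_flow)
qed (simp add: thin_flow_simps expectation_thin_step finite_set_pmf_thin_flow)

lemma tendsto_expectation_thin_step:
  fixes F :: "'a multiset \<Rightarrow> real" and p :: "real \<Rightarrow> real"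
  assumes fin: "\<And>t. finite (set_pmf (D t))" and p: "\<And>t. 0 \<le> t \<Longrightarrow> 0 \<le> p t \<and> p t \<le> 1"
    and "(p \<longlongrightarrow> q) at_top"
    and "((\<lambda>t. measure_pmf.expectation (D t) (\<lambda>\<psi>. F (add_mset x \<psi>))) \<longlongrightarrow> l') at_top"
    and "((\<lambda>t. measure_pmf.expectation (D t) F) \<longlongrightarrow> l) at_top"
  shows "((\<lambda>t. measure_pmf.expectation (thin_step (p t) x (D t)) F) \<longlongrightarrow> q * l' + (1 - q) * l) at_top"
proof (rule Lim_transform_eventually)
  show "((\<lambda>t. p t * measure_pmf.expectation (D t) (\<lambda>\<psi>. F (add_mset x \<psi>))
      + (1 - p t) * measure_pmf.expectation (D t) F) \<longlongrightarrow> q * l' + (1 - q) * l) at_top"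
    by (intro tendsto_intros assms)
  show "\<forall>\<^sub>F t in at_top. p t * measure_pmf.expectation (D t) (\<lambda>\<psi>. F (add_mset x \<psi>))
      + (1 - p t) * measure_pmf.expectation (D t) F = measure_pmf.expectation (thin_step (p t) x (D t)) F"
    by (rule eventually_mono[OF eventually_ge_at_top[of 0]]) (use fin p in \<open>simp add: expectation_thin_step\<close>)
qed

lemma tendsto_exp_minus_at_top: "((\<lambda>t. exp (- t) :: real) \<longlongrightarrow> 0) at_top"
  by (rule filterlim_compose[OF exp_at_bot filterlim_uminus_at_bot_at_top])

text \<open>The coins of \<open>\<phi>\<close> fail and those of \<open>\<xi>\<close> succeed in the
  limit. \<open>F\<close> is generalised because each coin evaluates it with and without the new
  point.\<close>

lemma tendsto_expectation_thin_flow: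
  fixes F :: "'a multiset \<Rightarrow> real"
  shows "((\<lambda>t. measure_pmf.expectation (thin_flow \<phi> \<xi> t) F) \<longlongrightarrow> F \<xi>) at_top"
proof (induction \<xi> arbitrary: F)
  case empty
  show ?case
  proof (induction \<phi> arbitrary: F)
    case empty
    show ?case by (simp add: thin_flow_simps)
  next
    case (add x \<phi>)
    have "((\<lambda>t. measure_pmf.expectation (thin_step (exp (- t)) x (thin_flow \<phi> {#} t)) F)
        \<longlongrightarrow> 0 * F (add_mset x {#}) + (1 - 0) * F {#}) at_top"
      by (rule tendsto_expectation_thin_step[OF finite_set_pmf_thin_flow _ tendsto_exp_minus_at_top
            add[of "\<lambda>\<psi>. F (add_mset x \<psi>)"] add]) auto
    then show ?case by (simp add: thin_flow_simps)
  qed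
next
  case (add x \<xi>)
  have "((\<lambda>t. 1 - exp (- t) :: real) \<longlongrightarrow> 1 - 0) at_top"
    by (intro tendsto_intros tendsto_exp_minus_at_top)
  then have lim: "((\<lambda>t. 1 - exp (- t) :: real) \<longlongrightarrow> 1) at_top"
    by simp
  have "((\<lambda>t. measure_pmf.expectation (thin_step (1 - exp (- t)) x (thin_flow \<phi> \<xi> t)) F)
      \<longlongrightarrow> 1 * F (add_mset x \<xi>) + (1 - 1) * F \<xi>) at_top"
    by (rule tendsto_expectation_thin_step[OF finite_set_pmf_thin_flow _ lim
          add[of "\<lambda>\<psi>. F (add_mset x \<psi>)"] add]) auto
  then show ?case by (simp add: thin_flow_simps)
qed

section \<open>Calculus on the half-line\<close>

text \<open>Differentiation under the integral sign on a half-line, one-sided at 0. The mean value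
  bound makes \<open>c\<close> dominate all difference quotients, and dominated convergence along
  sequences gives the limit.\<close>

lemma has_derivative_integral_dominated:
  fixes h d :: "real \<Rightarrow> 'b \<Rightarrow> real"
  assumes int: "\<And>t. 0 \<le> t \<Longrightarrow> integrable N (h t)"
    and der: "\<And>t \<omega>. 0 \<le> t \<Longrightarrow> \<omega> \<in> space N \<Longrightarrow>
      ((\<lambda>t. h t \<omega>) has_real_derivative d t \<omega>) (at t within {0..})"
    and bound: "\<And>t \<omega>. 0 \<le> t \<Longrightarrow> \<omega> \<in> space N \<Longrightarrow> \<bar>d t \<omega>\<bar> \<le> c \<omega>"
    and c: "integrable N c" and t: "0 \<le> t"
  shows "integrable N (d t)"
    and "((\<lambda>t. \<integral>\<omega>. h t \<omega> \<partial>N) has_real_derivative (\<integral>\<omega>. d t \<omega> \<partial>N)) (at t within {0..})"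
proof -
  have quot: "(\<lambda>i. (h (X i) \<omega> - h t \<omega>) / (X i - t)) \<longlonglongrightarrow> d t \<omega>"
    if "\<forall>i. X i \<in> {0..} - {t}" "X \<longlonglongrightarrow> t" "\<omega> \<in> space N" for X \<omega>
    using der[OF t that(3)] that(1,2)
    unfolding has_field_derivative_iff tendsto_at_iff_sequentially by (auto simp: comp_def)
  have quot_le: "\<bar>(h s \<omega> - h t \<omega>) / (s - t)\<bar> \<le> c \<omega>"
    if "s \<in> {0..} - {t}" "\<omega> \<in> space N" for s \<omega>
  proof -
    have "norm (h s \<omega> - h t \<omega>) \<le> c \<omega> * norm (s - t)"
      by (rule field_differentiable_bound[of "{0..}" "\<lambda>t. h t \<omega>" "\<lambda>t. d t \<omega>"])
        (use that t der bound in auto)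
    then show ?thesis
      using that by (simp add: field_simps)
  qed
  \<comment> \<open>A concrete sequence in the half-line that avoids \<open>t\<close>: it exhibits
    \<open>d t\<close> as a limit of measurable difference quotients, hence as measurable.\<close>
  define X0 where "X0 i = t + inverse (real (Suc i))" for i
  have X0: "X0 i \<in> {0..} - {t}" for i
    using t by (auto simp: X0_def)
  have "X0 \<longlonglongrightarrow> t + 0"
    unfolding X0_def by (intro tendsto_intros LIMSEQ_inverse_real_of_nat)
  then have X0_lim: "X0 \<longlonglongrightarrow> t" by simp
  have meas_h: "h s \<in> borel_measurable N" if "0 \<le> s" for s
    using int[OF that] by simp
  have meas_d: "d t \<in> borel_measurable N"
    by (rule borel_measurable_LIMSEQ_real[OF quot[of X0]])
      (use X0 X0_lim t meas_h in \<open>auto intro!: borel_measurable_divide borel_measurable_diff\<close>)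
  show "integrable N (d t)"
    by (rule Bochner_Integration.integrable_bound[OF c meas_d])
      (use bound[OF t] in \<open>auto intro!: AE_I2 intro: order_trans[OF _ abs_ge_self]\<close>)
  show "((\<lambda>t. \<integral>\<omega>. h t \<omega> \<partial>N) has_real_derivative (\<integral>\<omega>. d t \<omega> \<partial>N)) (at t within {0..})"
    unfolding has_field_derivative_iff tendsto_at_iff_sequentially comp_def
  proof (intro allI impI)
    fix X :: "nat \<Rightarrow> real" assume X: "\<forall>i. X i \<in> {0..} - {t}" "X \<longlonglongrightarrow> t"
    have "(\<lambda>i. \<integral>\<omega>. (h (X i) \<omega> - h t \<omega>) / (X i - t) \<partial>N) \<longlonglongrightarrow> (\<integral>\<omega>. d t \<omega> \<partial>N)"
    proof (rule integral_dominated_convergence[where w = c, OF meas_d _ c])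
      show "(\<lambda>\<omega>. (h (X i) \<omega> - h t \<omega>) / (X i - t)) \<in> borel_measurable N" for i
        using X t meas_h by (auto intro!: borel_measurable_divide borel_measurable_diff)
      show "AE \<omega> in N. (\<lambda>i. (h (X i) \<omega> - h t \<omega>) / (X i - t)) \<longlonglongrightarrow> d t \<omega>"
        using quot[OF X] by (intro AE_I2) auto
      show "AE \<omega> in N. norm ((h (X i) \<omega> - h t \<omega>) / (X i - t)) \<le> c \<omega>" for i
        using quot_le X(1) unfolding real_norm_def by (intro AE_I2) blast
    qed
    moreover have "(\<integral>\<omega>. (h (X i) \<omega> - h t \<omega>) / (X i - t) \<partial>N)
        = ((\<integral>\<omega>. h (X i) \<omega> \<partial>N) - (\<integral>\<omega>. h t \<omega> \<partial>N)) / (X i - t)" for i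
      using X t int by simp
    ultimately show "(\<lambda>i. ((\<integral>\<omega>. h (X i) \<omega> \<partial>N) - (\<integral>\<omega>. h t \<omega> \<partial>N)) / (X i - t)) \<longlonglongrightarrow> (\<integral>\<omega>. d t \<omega> \<partial>N)"
      by (simp only:)
  qed
qed

lemma set_integrable_exp_minus: "set_integrable lborel {0..} (\<lambda>t. C * exp (- t) :: real)"
proof -
  have "integrable lborel (\<lambda>t. indicator {0..} t * exp (- t) :: real)"
  proof (rule integrableI_nn_integral_finite[where x = 1])
    have "(\<integral>\<^sup>+t. ennreal (indicator {0..} t * exp (- t)) \<partial>lborel)
        = (\<integral>\<^sup>+t. ennreal (t ^ 0 * exp (- t)) * indicator {0..} t \<partial>lborel)"
      by (intro nn_integral_cong) (auto simp: indicator_def)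
    then show "(\<integral>\<^sup>+t. ennreal (indicator {0..} t * exp (- t)) \<partial>lborel) = ennreal 1"
      using nn_intergal_power_times_exp_Ici[of 0] by simp
  qed auto
  from integrable_mult_right[OF this, of C] show ?thesis
    by (simp add: set_integrable_def mult_ac)
qed

text \<open>The fundamental theorem on \<open>[0, b]\<close> followed by \<open>b\<close> tending to
  infinity; the exponential bound supplies integrability of \<open>D\<close> on the
  half-line.\<close>

lemma integral_halfline_FTC:
  fixes \<Psi> D :: "real \<Rightarrow> real"
  assumes der: "\<And>t. 0 \<le> t \<Longrightarrow> (\<Psi> has_real_derivative D t) (at t within {0..})"
    and bound: "\<And>t. 0 \<le> t \<Longrightarrow> \<bar>D t\<bar> \<le> C * exp (- t)"
    and lim: "(\<Psi> \<longlongrightarrow> L) at_top"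
  shows "set_integrable lborel {0..} D" "(LINT t:{0..}|lborel. D t) = L - \<Psi> 0"
proof -
  have cont: "continuous_on {0..} \<Psi>"
    using der by (auto simp: continuous_on_eq_continuous_within intro: DERIV_continuous)
  \<comment> \<open>Measurability of \<open>D\<close> is derived from the continuity of
    \<open>\<Psi>\<close>. Forward quotients are used so that their arguments stay in the
    half-line.\<close>
  define f where "f n t = indicator {0..} t *\<^sub>R ((\<Psi> (t + inverse (real (Suc n))) - \<Psi> t) / inverse (real (Suc n)))"
    for n t
  have "f n \<in> borel_measurable borel" for n
    unfolding f_def
    by (rule borel_measurable_continuous_on_indicator)
      (auto intro!: continuous_intros continuous_on_compose2[OF cont])
  moreover have "(\<lambda>n. f n t) \<longlonglongrightarrow> indicator {0..} t *\<^sub>R D t" for t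
  proof (cases "0 \<le> t")
    case True
    define X where "X n = t + inverse (real (Suc n))" for n
    have "\<forall>n. X n \<in> {0..} - {t}"
      using True by (auto simp: X_def)
    moreover have "X \<longlonglongrightarrow> t + 0"
      unfolding X_def by (intro tendsto_intros LIMSEQ_inverse_real_of_nat)
    ultimately have "(\<lambda>n. (\<Psi> (X n) - \<Psi> t) / (X n - t)) \<longlonglongrightarrow> D t"
      using der[OF True] unfolding has_field_derivative_iff tendsto_at_iff_sequentially
      by (auto simp: comp_def)
    then show ?thesis
      using True by (simp add: f_def X_def)
  qed (simp add: f_def)
  ultimately have "(\<lambda>t. indicator {0..} t *\<^sub>R D t) \<in> borel_measurable borel"
    by (rule borel_measurable_LIMSEQ_real[rotated])
  then have meas: "set_borel_measurable lborel {0..} D"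
    by (simp add: set_borel_measurable_def)
  show int: "set_integrable lborel {0..} D"
    by (rule set_integrable_bound[OF set_integrable_exp_minus[of C] meas])
      (use bound in \<open>auto intro!: AE_I2 intro: order_trans[OF _ abs_ge_self]\<close>)
  have "((\<lambda>b. LINT t:{0..b}|lborel. D t) \<longlongrightarrow> (LINT t:{0..}|lborel. D t)) at_top"
    by (rule tendsto_set_lebesgue_integral_at_top[OF _ int]) simp
  moreover have "((\<lambda>b. LINT t:{0..b}|lborel. D t) \<longlongrightarrow> L - \<Psi> 0) at_top"
  proof (rule Lim_transform_eventually)
    show "((\<lambda>b. \<Psi> b - \<Psi> 0) \<longlongrightarrow> L - \<Psi> 0) at_top"
      by (intro tendsto_intros lim)
    show "\<forall>\<^sub>F b in at_top. \<Psi> b - \<Psi> 0 = (LINT t:{0..b}|lborel. D t)"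
      using eventually_ge_at_top[of "0::real"]
    proof eventually_elim
      case (elim b)
      \<comment> \<open>The gauge integral integrates any derivative, continuous or not; set
        integrability then identifies it with the Lebesgue integral.\<close>
      have "(D has_integral \<Psi> b - \<Psi> 0) {0..b}"
      proof (rule fundamental_theorem_of_calculus[OF elim])
        fix t assume "t \<in> {0..b}"
        then show "(\<Psi> has_vector_derivative D t) (at t within {0..b})"
          using has_field_derivative_subset[OF der[of t], of "{0..b}"]
          by (auto simp: has_real_derivative_iff_has_vector_derivative)
      qed
      moreover have "set_integrable lborel {0..b} D"
        by (rule set_integrable_subset[OF int]) auto
      ultimately show ?case
        by (simp add: set_borel_integral_eq_integral(2) integral_unique)
    qed
  qed
  ultimately show "(LINT t:{0..}|lborel. D t) = L - \<Psi> 0"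
    by (rule tendsto_unique[rotated]) simp
qed

section \<open>Integration of the generator\<close>

lemma abs_expectation_thin_flow_le:
  assumes F: "add_lipschitz F"
  shows "measure_pmf.expectation (thin_flow \<phi> \<xi> t) (\<lambda>\<psi>. \<bar>F \<psi>\<bar>) \<le> \<bar>F {#}\<bar> + real (size \<phi>) + real (size \<xi>)"
proof -
  have "measure_pmf.expectation (thin_flow \<phi> \<xi> t) (\<lambda>\<psi>. \<bar>F \<psi>\<bar>)
      \<le> measure_pmf.expectation (thin_flow \<phi> \<xi> t) (\<lambda>_. \<bar>F {#}\<bar> + real (size \<phi>) + real (size \<xi>))"
  proof (rule integral_mono_AE)
    show "AE \<psi> in measure_pmf (thin_flow \<phi> \<xi> t). \<bar>F \<psi>\<bar> \<le> \<bar>F {#}\<bar> + real (size \<phi>) + real (size \<xi>)"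
    proof (rule AE_pmfI)
      fix \<psi> assume "\<psi> \<in> set_pmf (thin_flow \<phi> \<xi> t)"
      then show "\<bar>F \<psi>\<bar> \<le> \<bar>F {#}\<bar> + real (size \<phi>) + real (size \<xi>)"
        using add_lipschitz_abs_le[OF F, of \<psi>] size_thin_flow[of \<psi> \<phi> \<xi> t] by linarith
    qed
  qed (simp_all add: integrable_measure_pmf_finite finite_set_pmf_thin_flow)
  then show ?thesis by simp
qed

text \<open>The conjuncts on integrability and on the generator domain ensure that neither the
  integrals nor \<open>glauber_generator\<close> take a default value in the final equation.\<close>

theorem theorem3p6:
  fixes M :: "'a::metric_space measure"
    and \<Omega> :: "'w measure"
    and \<zeta> :: "'w \<Rightarrow> 'a multiset"
    and F :: "'a multiset \<Rightarrow> real"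
    and \<phi> :: "'a multiset"
  defines "Q \<equiv> distr \<Omega> config_space \<zeta>"
  assumes "locally compact (UNIV :: 'a set)"
    and "finite_measure M" and "sets M = sets borel"
    and "poisson_process \<Omega> \<zeta> M"
    and "F \<in> borel_measurable config_space"
    and "TV_lipschitz1 F"
  shows "integrable \<Omega> (\<lambda>\<omega>. F (\<zeta> \<omega>))
    \<and> (\<forall>s\<ge>0. in_generator_domain Q (glauber_semigroup Q s F) \<phi>)
    \<and> set_integrable lborel {0..} (\<lambda>s. glauber_generator Q (glauber_semigroup Q s F) \<phi>)
    \<and> (\<integral>\<omega>. F (\<zeta> \<omega>) \<partial>\<Omega>) - F \<phi>
        = (LINT s:{0..}|lborel. glauber_generator Q (glauber_semigroup Q s F) \<phi>)"
proof -

  \<comment> \<open>Setting and functional of the Poisson law\<close>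
  note P = \<open>poisson_process \<Omega> \<zeta> M\<close>
  note F_meas [measurable] = \<open>F \<in> borel_measurable config_space\<close>
  note \<zeta>_meas [measurable] = poisson_processD(2)[OF P]
  have F: "add_lipschitz F"
    using \<open>TV_lipschitz1 F\<close> by (rule TV_lipschitz1_imp_add_lipschitz)
  interpret \<Omega>: prob_space \<Omega> by (rule poisson_processD(1)[OF P])
  interpret Q: config_prob_space Q
  proof (intro config_prob_space.intro config_prob_space_axioms.intro)
    show "prob_space Q"
      unfolding Q_def by (rule \<Omega>.prob_space_distr) (rule \<zeta>_meas)
    show "sets Q = sets config_space"
      by (simp add: Q_def)
  qed
  have gen_Q: "(\<integral>\<psi>. gen_fun u \<psi> \<partial>Q) = exp (- (\<integral>x. 1 - u x \<partial>M))" if "u \<in> test_funs" for u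
    unfolding Q_def integral_distr[OF \<zeta>_meas borel_measurable_gen_fun[OF that]]
    by (rule poisson_process_gen_fun[OF P \<open>finite_measure M\<close> \<open>sets M = sets borel\<close> that])
  note size_int = poisson_process_integrable_size[OF P]

  \<comment> \<open>Conditioning on the Poisson process\<close>
  define h where "h \<psi> t \<omega> = measure_pmf.expectation (thin_flow \<psi> (\<zeta> \<omega>) t) F" for \<psi> t \<omega>
  \<comment> \<open>One integrable bound serves throughout: the first term and linear growth control
    \<open>h\<close>, and the two sizes control its derivative, uniformly in time.\<close>
  define c where "c \<psi> \<omega> = \<bar>F {#}\<bar> + real (size \<psi>) + real (size (\<zeta> \<omega>))" for \<psi> :: "'a multiset" and \<omega>
  have c_int: "integrable \<Omega> (c \<psi>)" for \<psi>
    unfolding c_def using size_int by simp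
  have h_le: "\<bar>h \<psi> t \<omega>\<bar> \<le> c \<psi> \<omega>" for \<psi> t \<omega>
    unfolding h_def c_def
    by (rule order_trans[OF integral_abs_bound abs_expectation_thin_flow_le[OF F]])

  \<comment> \<open>\<open>F\<close> grows at most linearly and the flow carries no more points than
    \<open>\<psi>\<close> and the Poisson configuration together, so the first moment of the size
    suffices.\<close>
  have finQ: "(\<integral>\<^sup>+\<xi>. \<integral>\<^sup>+\<psi>'. ennreal \<bar>F \<psi>'\<bar> \<partial>config_law (thin_flow \<psi> \<xi> t) \<partial>Q) < \<infinity>"
    if "0 \<le> t" for \<psi> t
  proof -
    have m: "(\<lambda>\<xi>. \<integral>\<^sup>+\<psi>'. ennreal \<bar>F \<psi>'\<bar> \<partial>config_law (thin_flow \<psi> \<xi> t)) \<in> borel_measurable Q"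
      by (rule measurable_compose[OF Q.measurable_thin_flow[OF that] nn_integral_measurable_subprob_algebra]) measurable
    have le: "(\<integral>\<^sup>+\<psi>'. ennreal \<bar>F \<psi>'\<bar> \<partial>config_law (thin_flow \<psi> (\<zeta> \<omega>) t)) \<le> ennreal (c \<psi> \<omega>)" for \<omega>
    proof -
      have "(\<integral>\<^sup>+\<psi>'. ennreal \<bar>F \<psi>'\<bar> \<partial>config_law (thin_flow \<psi> (\<zeta> \<omega>) t))
          = ennreal (measure_pmf.expectation (thin_flow \<psi> (\<zeta> \<omega>) t) (\<lambda>\<psi>'. \<bar>F \<psi>'\<bar>))"
        by (subst nn_integral_config_law)
          (auto intro!: nn_integral_eq_integral integrable_measure_pmf_finite finite_set_pmf_thin_flow)
      also have "\<dots> \<le> ennreal (c \<psi> \<omega>)"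
        unfolding c_def by (intro ennreal_leI abs_expectation_thin_flow_le F)
      finally show ?thesis .
    qed
    have "(\<integral>\<^sup>+\<xi>. \<integral>\<^sup>+\<psi>'. ennreal \<bar>F \<psi>'\<bar> \<partial>config_law (thin_flow \<psi> \<xi> t) \<partial>Q)
        = (\<integral>\<^sup>+\<omega>. \<integral>\<^sup>+\<psi>'. ennreal \<bar>F \<psi>'\<bar> \<partial>config_law (thin_flow \<psi> (\<zeta> \<omega>) t) \<partial>\<Omega>)"
      unfolding Q_def by (rule nn_integral_distr[OF \<zeta>_meas m[unfolded Q_def]])
    also have "\<dots> \<le> (\<integral>\<^sup>+\<omega>. ennreal (c \<psi> \<omega>) \<partial>\<Omega>)"
      by (intro nn_integral_mono le)
    also have "\<dots> = ennreal (\<integral>\<omega>. c \<psi> \<omega> \<partial>\<Omega>)"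
      by (rule nn_integral_eq_integral[OF c_int]) (simp add: c_def)
    also have "\<dots> < \<infinity>" by simp
    finally show ?thesis .
  qed
  have law: "integrable (glauber_law Q t \<psi>) F" "glauber_semigroup Q t F \<psi> = (\<integral>\<omega>. h \<psi> t \<omega> \<partial>\<Omega>)"
      "integrable \<Omega> (h \<psi> t)" if "0 \<le> t" for t \<psi>
  proof -
    have Q_ne: "space Q \<noteq> {}" by simp
    note bind = integral_bind_integrable[OF Q.measurable_thin_flow[OF that] F_meas finQ[OF that] Q_ne, of \<psi>]
    show "integrable (glauber_law Q t \<psi>) F"
      unfolding Q.glauber_law_conv_bind[OF that] by (rule bind(1))
    have int: "integrable (distr \<Omega> config_space \<zeta>) (\<lambda>\<xi>. measure_pmf.expectation (thin_flow \<psi> \<xi> t) F)"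
      using bind(3) unfolding integral_config_law[OF F_meas] Q_def .
    then show "integrable \<Omega> (h \<psi> t)"
      unfolding h_def by (rule integrable_distr[OF \<zeta>_meas])
    show "glauber_semigroup Q t F \<psi> = (\<integral>\<omega>. h \<psi> t \<omega> \<partial>\<Omega>)"
      unfolding glauber_semigroup_def Q.glauber_law_conv_bind[OF that] bind(2) integral_config_law[OF F_meas]
      unfolding Q_def h_def by (rule integral_distr[OF \<zeta>_meas]) (use int in auto)
  qed

  \<comment> \<open>Semigroup property for the Lipschitz function\<close>
  have semigroup: "glauber_semigroup Q t (glauber_semigroup Q s F) \<phi> = glauber_semigroup Q (t + s) F \<phi>"
    if "0 \<le> s" "0 \<le> t" for s t
  proof -
    have K: "glauber_law Q s \<in> glauber_law Q t \<phi> \<rightarrow>\<^sub>M subprob_algebra config_space"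
      unfolding measurable_cong_sets[OF Q.sets_glauber_law refl] by (rule Q.measurable_glauber_law[OF that(1)])
    note eq = Q.glauber_law_semigroup[OF that gen_Q, where \<phi> = \<phi>]
    \<comment> \<open>The absolute iterated integral is the absolute moment of \<open>F\<close>
      under the law at time \<open>t + s\<close>, whose finiteness is already known.\<close>
    have "(\<integral>\<^sup>+\<psi>. \<integral>\<^sup>+\<psi>'. ennreal \<bar>F \<psi>'\<bar> \<partial>glauber_law Q s \<psi> \<partial>glauber_law Q t \<phi>)
        = (\<integral>\<^sup>+\<psi>'. ennreal \<bar>F \<psi>'\<bar> \<partial>(glauber_law Q t \<phi> \<bind> glauber_law Q s))"
      by (rule nn_integral_bind[OF _ K, symmetric]) measurable
    also have "\<dots> < \<infinity>"
      using law(1)[of "t + s" \<phi>] that by (simp add: eq integrable_iff_bounded)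
    finally show ?thesis
      using integral_bind_integrable(2)[OF K F_meas] by (simp add: glauber_semigroup_def eq)
  qed

  \<comment> \<open>Derivative of the semigroup in time\<close>
  have "\<exists>d. \<forall>t\<ge>0. ((\<lambda>t. h \<phi> t \<omega>) has_real_derivative d t) (at t within {0..})
      \<and> \<bar>d t\<bar> \<le> (real (size \<phi>) + real (size (\<zeta> \<omega>))) * exp (- t)" for \<omega>
    using decaying_derivative_thin_flow[of \<phi> "\<zeta> \<omega>"] F
    unfolding decaying_derivative_def h_def by blast
  then obtain d' where d': "\<forall>\<omega>. \<forall>t\<ge>0. ((\<lambda>t. h \<phi> t \<omega>) has_real_derivative d' \<omega> t) (at t within {0..})
      \<and> \<bar>d' \<omega> t\<bar> \<le> (real (size \<phi>) + real (size (\<zeta> \<omega>))) * exp (- t)"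
    by metis
  define d where "d t \<omega> = d' \<omega> t" for t \<omega>
  have d: "((\<lambda>t. h \<phi> t \<omega>) has_real_derivative d t \<omega>) (at t within {0..})"
      "\<bar>d t \<omega>\<bar> \<le> c \<phi> \<omega> * exp (- t)" "\<bar>d t \<omega>\<bar> \<le> c \<phi> \<omega>" if "0 \<le> t" for t \<omega>
  proof -
    show "((\<lambda>t. h \<phi> t \<omega>) has_real_derivative d t \<omega>) (at t within {0..})"
      using d' that by (simp add: d_def)
    have "\<bar>d t \<omega>\<bar> \<le> (real (size \<phi>) + real (size (\<zeta> \<omega>))) * exp (- t)"
      using d' that by (simp add: d_def)
    also have "\<dots> \<le> c \<phi> \<omega> * exp (- t)"
      by (rule mult_right_mono) (simp_all add: c_def)
    finally show *: "\<bar>d t \<omega>\<bar> \<le> c \<phi> \<omega> * exp (- t)" .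
    also have "\<dots> \<le> c \<phi> \<omega> * 1"
      using that by (intro mult_left_mono) (simp_all add: c_def)
    finally show "\<bar>d t \<omega>\<bar> \<le> c \<phi> \<omega>" by simp
  qed
  define \<Psi> where "\<Psi> t = (\<integral>\<omega>. h \<phi> t \<omega> \<partial>\<Omega>)" for t
  define D where "D t = (\<integral>\<omega>. d t \<omega> \<partial>\<Omega>)" for t
  \<comment> \<open>\<open>d'\<close> was chosen for each \<open>\<omega>\<close> separately; that
    \<open>d t\<close> is measurable in \<open>\<omega>\<close> comes from the differentiation
    lemma.\<close>
  have d_int: "integrable \<Omega> (d t)" and \<Psi>_der: "(\<Psi> has_real_derivative D t) (at t within {0..})"
    if "0 \<le> t" for t
    unfolding \<Psi>_def[abs_def] D_def
    by (rule has_derivative_integral_dominated[where h = "h \<phi>" and c = "c \<phi>", OF law(3) d(1) d(3) c_int that]; simp)+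
  have D_le: "\<bar>D t\<bar> \<le> (\<integral>\<omega>. c \<phi> \<omega> \<partial>\<Omega>) * exp (- t)" if "0 \<le> t" for t
  proof -
    have "\<bar>D t\<bar> \<le> (\<integral>\<omega>. \<bar>d t \<omega>\<bar> \<partial>\<Omega>)"
      unfolding D_def by (rule integral_abs_bound)
    also have "\<dots> \<le> (\<integral>\<omega>. c \<phi> \<omega> * exp (- t) \<partial>\<Omega>)"
      by (rule integral_mono) (use that c_int d_int d(2) in auto)
    finally show ?thesis by simp
  qed

  \<comment> \<open>Limit at infinity and value at zero\<close>
  have h_lim: "((\<lambda>t. h \<phi> t \<omega>) \<longlongrightarrow> F (\<zeta> \<omega>)) at_top" for \<omega>
    unfolding h_def by (rule tendsto_expectation_thin_flow)
  have F\<zeta>_int: "integrable \<Omega> (\<lambda>\<omega>. F (\<zeta> \<omega>))"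
    by (rule Bochner_Integration.integrable_bound[OF c_int[of "{#}"]])
      (auto simp: c_def intro!: AE_I2 order_trans[OF add_lipschitz_abs_le[OF F]])
  have \<Psi>_lim: "(\<Psi> \<longlongrightarrow> (\<integral>\<omega>. F (\<zeta> \<omega>) \<partial>\<Omega>)) at_top"
  proof (rule Lim_transform_eventually)
    \<comment> \<open>Measurability of \<open>h \<phi> t\<close> is established for nonnegative
      times, whereas dominated convergence asks for it at all real times; truncating at 0 does not
      affect the limit.\<close>
    have max: "\<forall>\<^sub>F t in at_top. max 0 t = (t::real)"
      using eventually_ge_at_top[of 0] by eventually_elim auto
    show "((\<lambda>t. \<Psi> (max 0 t)) \<longlongrightarrow> (\<integral>\<omega>. F (\<zeta> \<omega>) \<partial>\<Omega>)) at_top"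
      unfolding \<Psi>_def
    proof (rule integral_dominated_convergence_at_top[where w = "c \<phi>"])
      show "h \<phi> (max 0 t) \<in> borel_measurable \<Omega>" for t
        using law(3)[of "max 0 t" \<phi>] by simp
      have "((\<lambda>t. h \<phi> (max 0 t) \<omega>) \<longlongrightarrow> F (\<zeta> \<omega>)) at_top" for \<omega>
        by (rule Lim_transform_eventually[OF h_lim]) (use max in eventually_elim, simp)
      then show "AE \<omega> in \<Omega>. ((\<lambda>t. h \<phi> (max 0 t) \<omega>) \<longlongrightarrow> F (\<zeta> \<omega>)) at_top"
        by simp
    qed (use h_le c_int in auto)
    show "\<forall>\<^sub>F t in at_top. \<Psi> (max 0 t) = \<Psi> t"
      using max by eventually_elim simp
  qed
  have \<Psi>_0: "\<Psi> 0 = F \<phi>"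
    by (simp add: \<Psi>_def h_def expectation_thin_flow_0 \<Omega>.prob_space)

  \<comment> \<open>Identification of the generator\<close>
  have gen: "((\<lambda>t. glauber_semigroup Q t (glauber_semigroup Q s F) \<phi>) has_vector_derivative D s) (at 0 within {0..})"
    if "0 \<le> s" for s
  proof -
    \<comment> \<open>By the semigroup property the derivative at time 0 started from
      \<open>s\<close> is that of \<open>\<Psi>\<close> at \<open>s\<close> within
      \<open>{s..}\<close>, obtained by restriction from \<open>{0..}\<close> and
      translation.\<close>
    have "(+) s ` {0..} = {s..}"
      by (simp add: image_add_atLeast)
    then have "(\<Psi> has_real_derivative D s) (at (s + 0) within (+) s ` {0..})"
      using has_field_derivative_subset[OF \<Psi>_der[OF that], of "{s..}"] that by simp
    moreover have "((+) s has_real_derivative 1) (at 0 within {0..})"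
      by (auto intro!: derivative_eq_intros)
    ultimately have "(\<Psi> \<circ> (+) s has_real_derivative D s * 1) (at 0 within {0..})"
      by (rule DERIV_image_chain)
    then have "((\<lambda>t. \<Psi> (s + t)) has_vector_derivative D s) (at 0 within {0..})"
      by (simp add: comp_def has_real_derivative_iff_has_vector_derivative)
    then show ?thesis
    proof (rule has_vector_derivative_weaken)
      fix t :: real assume "t \<in> {0..}"
      then show "\<Psi> (s + t) = glauber_semigroup Q t (glauber_semigroup Q s F) \<phi>"
        using semigroup[OF that, of t] law(2)[of "t + s" \<phi>] that by (simp add: \<Psi>_def add.commute)
    qed auto
  qed
  \<comment> \<open>The point 0 is an accumulation point of the half-line, so the one-sided
    derivative is unique and \<open>vector_derivative\<close> selects it.\<close>
  have generator: "glauber_generator Q (glauber_semigroup Q s F) \<phi> = D s" if "0 \<le> s" for s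
    unfolding glauber_generator_def
    by (rule vector_derivative_within[OF _ gen[OF that]]) (simp add: at_within_Ici_at_right)
  have domain: "in_generator_domain Q (glauber_semigroup Q s F) \<phi>" if "0 \<le> s" for s
    unfolding in_generator_domain_def using gen[OF that] by (rule differentiableI_vector)
  note FTC = integral_halfline_FTC[OF \<Psi>_der D_le \<Psi>_lim]
  have "set_integrable lborel {0..} (\<lambda>s. glauber_generator Q (glauber_semigroup Q s F) \<phi>)"
    using FTC(1) by (rule set_integrable_cong[THEN iffD1, rotated -1]) (simp_all add: generator)
  moreover have "(LINT s:{0..}|lborel. glauber_generator Q (glauber_semigroup Q s F) \<phi>) = (LINT s:{0..}|lborel. D s)"
    by (rule set_lebesgue_integral_cong) (auto simp: generator)
  ultimately show ?thesis
    using F\<zeta>_int domain FTC(2) by (simp add: \<Psi>_0)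
qed

end
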